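(* Let $(S_k,X_k)_{k\ge0}$ be an $\mathbb{S}\times\mathbb{X}$-valued process adapted to a filtration $(\mathcal{F}_k)_{k\ge0}$ such that $\mathbb{P}(X_{k+1}\in A\mid\mathcal{F}_k)=P_{S_k}(X_k,A)$ a.s. for all $k\ge0$ and measurable $A\subset\mathbb{X}$. Suppose there exist constants $C<\infty$ and $\rho\in[0,1)$ such that $d_{\mathrm{tv}}(P_s^k(x,\cdot),\pi)\le C\rho^k$ for all $x\in\mathbb{X}$, $s\in\mathbb{S}$, $k\ge0$. Let $\varphi:\mathbb{X}\to\mathbb{R}$ be bounded and measurable. (i) If the adaptation is weakly $1$-waning, then $\frac1n\sum_{k=1}^n\varphi(X_k)\to\pi(\varphi)$ in probability as $n\to\infty$. (ii) If the adaptation is strongly $1$-waning, then $\frac1n\sum_{k=1}^n\varphi(X_k)\to\pi(\varphi)$ almost surely as $n\to\infty$. (iii) Suppose the adaptation is (weakly or strongly) $\tfrac12$-waning and that there is a constant $\sigma_\varphi^2\in[0,\infty)$ such that, with $g_s(x)=\sum_{k=0}^\infty P_s^k\bar\varphi(x)$ and $\bar\varphi=\varphi-\pi(\varphi)$, $$\frac1n\sum_{k=1}^n\big[P_{S_{k-1}}g_{S_{k-1}}^2(X_{k-1})-(P_{S_{k-1}}g_{S_{k-1}})^2(X_{k-1})\big]\xrightarrow{n\to\infty}\sigma_\varphi^2\quad\text{in probability.}$$ Then $$\frac1{\sqrt n}\sum_{k=1}^n\big[\varphi(X_k)-\pi(\varphi)\big]\xrightarrow{n\to\infty}N(0,\sigma_\varphi^2)\quad\text{in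 distribution.}$$
   Context: $(\mathbb{X},\mathcal{X})$ and $(\mathbb{S},\mathcal{S})$ are measurable spaces. $\pi$ is a probability measure on $\mathbb{X}$ and $\{P_s\}_{s\in\mathbb{S}}$ is a family of Markov transition probabilities on $\mathbb{X}$, each $\pi$-invariant, such that $(s,x)\mapsto P_s(x,A)$ is $\mathcal{S}\otimes\mathcal{X}$-measurable for all $A\in\mathcal{X}$. Waning adaptation: for $p>0$, the adaptation is called weakly (respectively, strongly) $p$-waning if there are random variables $D_k$, $k\ge1$, with values in $[0,1]$ such that $\sup_{x\in\mathbb{X}}d_{\mathrm{tv}}\big(P_{S_k}(x,\cdot),P_{S_{k-1}}(x,\cdot)\big)\le D_k$ for all $k\ge1$, and $n^{-p}\sum_{k=1}^nD_k\to0$ in probability (respectively, almost surely) as $n\to\infty$. Notation: $\pi(f)=\int f\,d\pi$, $(Pf)(x)=\int P(x,dy)f(y)$, $P^0$ is the identity, $\rho^0=1$; $d_{\mathrm{tv}}(\mu,\nu)=\sup_A|\mu(A)-\nu(A)|$; $N(0,\sigma^2)$ is the centred normal law with variance $\sigma^2$ (point mass at $0$ if $\sigma^2=0$). Under the stated ergodicity hypothesis the series defining $g_s$ converges and $(s,x)\mapsto g_s(x)$ is bounded and measurable. *)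

theory Defs
  imports "HOL-Probability.Probability"
begin

text \<open>Transition kernels on a measurable space \<open>E\<close> are functions \<open>K :: 'x \<Rightarrow> 'x measure\<close>, measurable
  from \<open>E\<close> to \<open>prob_algebra E\<close>.\<close>

primrec kernel_power :: "'x measure \<Rightarrow> ('x \<Rightarrow> 'x measure) \<Rightarrow> nat \<Rightarrow> 'x \<Rightarrow> 'x measure" where
  "kernel_power E K 0 = return E"
| "kernel_power E K (Suc n) = (\<lambda>x. Giry_Monad.bind (kernel_power E K n x) K)"

definition kernel_app :: "('x \<Rightarrow> 'x measure) \<Rightarrow> ('x \<Rightarrow> real) \<Rightarrow> 'x \<Rightarrow> real" where
  "kernel_app K f x = (\<integral>y. f y \<partial>K x)"

text \<open>Only meaningful for finite measures with the same sigma-algebra (the set of differences is then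
  nonempty and bounded, so the real supremum is genuine).\<close>

definition tv_dist :: "'x measure \<Rightarrow> 'x measure \<Rightarrow> real" where
  "tv_dist \<mu> \<nu> = (SUP A\<in>sets \<mu>. \<bar>measure \<mu> A - measure \<nu> A\<bar>)"

text \<open>Only meaningful for measurable \<open>Y n\<close>, as \<open>measure\<close> vanishes on non-measurable sets.\<close>

definition tendsto_in_prob :: "'w measure \<Rightarrow> (nat \<Rightarrow> 'w \<Rightarrow> real) \<Rightarrow> real \<Rightarrow> bool" where
  "tendsto_in_prob M Y c \<longleftrightarrow>
     (\<forall>\<epsilon>>0. (\<lambda>n. measure M {\<omega>\<in>space M. \<bar>Y n \<omega> - c\<bar> > \<epsilon>}) \<longlonglongrightarrow> 0)"

definition adaptation_bound ::
  "'w measure \<Rightarrow> 'x measure \<Rightarrow> ('s \<Rightarrow> 'x \<Rightarrow> 'x measure) \<Rightarrow> (nat \<Rightarrow> 'w \<Rightarrow> 's) \<Rightarrow>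
    (nat \<Rightarrow> 'w \<Rightarrow> real) \<Rightarrow> bool" where
  "adaptation_bound M E P S D \<longleftrightarrow>
     (\<forall>k\<ge>1. D k \<in> borel_measurable M \<and>
       (\<forall>\<omega>\<in>space M. D k \<omega> \<in> {0..1} \<and>
         (SUP x\<in>space E. tv_dist (P (S k \<omega>) x) (P (S (k - 1) \<omega>) x)) \<le> D k \<omega>))"

definition weakly_waning ::
  "'w measure \<Rightarrow> 'x measure \<Rightarrow> ('s \<Rightarrow> 'x \<Rightarrow> 'x measure) \<Rightarrow> (nat \<Rightarrow> 'w \<Rightarrow> 's) \<Rightarrow> real \<Rightarrow> bool" where
  "weakly_waning M E P S p \<longleftrightarrow>
     (\<exists>D. adaptation_bound M E P S D \<and>
       tendsto_in_prob M (\<lambda>n \<omega>. real n powr (- p) * (\<Sum>k=1..n. D k \<omega>)) 0)"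

definition strongly_waning ::
  "'w measure \<Rightarrow> 'x measure \<Rightarrow> ('s \<Rightarrow> 'x \<Rightarrow> 'x measure) \<Rightarrow> (nat \<Rightarrow> 'w \<Rightarrow> 's) \<Rightarrow> real \<Rightarrow> bool" where
  "strongly_waning M E P S p \<longleftrightarrow>
     (\<exists>D. adaptation_bound M E P S D \<and>
       (AE \<omega> in M. (\<lambda>n. real n powr (- p) * (\<Sum>k=1..n. D k \<omega>)) \<longlonglongrightarrow> 0))"

definition poisson_sol ::
  "'x measure \<Rightarrow> 'x measure \<Rightarrow> ('x \<Rightarrow> 'x measure) \<Rightarrow> ('x \<Rightarrow> real) \<Rightarrow> 'x \<Rightarrow> real" where
  "poisson_sol E \<mu> K f x =
     (\<Sum>k. kernel_app (kernel_power E K k) (\<lambda>y. f y - (\<integral>z. f z \<partial>\<mu>)) x)"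

definition centred_normal :: "real \<Rightarrow> real measure" where
  "centred_normal v =
     (if v = 0 then return borel 0 else density lborel (\<lambda>x. ennreal (normal_density 0 (sqrt v) x)))"

end

theory Submission
  imports Defs
begin

text \<open>
  The solutions \<open>g s\<close> of the Poisson equations \<open>g s - P s (g s) = \<phi> - \<pi>(\<phi>)\<close> turn the centred sums
  of \<open>\<phi> (X k)\<close> into a martingale with bounded increments
  \<open>g (S k) (X (k + 1)) - P (S k) (g (S k)) (X k)\<close>, a bounded telescoping sum, and the adaptation error
  \<open>\<Sum> g (S k) (X k) - g (S (k - 1)) (X k)\<close>. The last is at most a constant times \<open>\<Sum> D k\<close>,
  because \<open>h = g s - g t\<close> has \<open>\<pi>\<close>-mean zero and residual \<open>h - P s h = (P s - P t) (g t)\<close>, which is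
  small in the supremum norm when \<open>P s\<close> and \<open>P t\<close> are close, and geometric ergodicity bounds \<open>h\<close> by
  its residual. Waning makes the adaptation error negligible at the scale \<open>n\<close> or \<open>sqrt n\<close>. For the
  martingale, orthogonality of increments gives the weak law; along squares it gives almost sure
  convergence, which bounded increments extend to all \<open>n\<close>; and compensated exponentials give the
  central limit theorem through Levy's continuity theorem.
\<close>

section \<open>Total variation distance\<close>

text \<open>The kernel used at time \<open>k\<close> is selected by a random parameter that may
  depend on the whole past, so ergodicity of each single \<open>P s\<close> says nothing directly
  about the chain. Hence only consecutive kernels are compared. Going through the residual of
  \<open>g s - g t\<close> involves a single application of \<open>P s - P t\<close>, instead of
  estimates for differences of all powers. Since \<open>C\<close> and \<open>\<rho>\<close> do not
  depend on the parameter, one constant bounds all solutions, and so the increments.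

  Martingale properties are expressed by testing against bounded \<open>F k\<close>-measurable
  weights, which is the form in which every later estimate uses them.

  For the central limit theorem only averages of the conditional variances converge, and only in
  probability. The exponential is therefore compensated by the random factor
  \<open>exp (u^2 * Q n / 2)\<close> and not by its limit. At \<open>u = t / sqrt n\<close> each
  step then costs an error of order \<open>n^(-3/2)\<close>, small enough to be summed over
  \<open>n\<close> steps; convergence of \<open>Q n / n\<close> enters once, at the end, to replace
  the compensator by a constant.\<close>

lemma (in prob_space) abs_expectation_le:
  fixes f :: "'a \<Rightarrow> real"
  assumes "\<And>x. x \<in> space M \<Longrightarrow> \<bar>f x\<bar> \<le> B"
  shows "\<bar>expectation f\<bar> \<le> B"
proof -
  have "0 \<le> B"
    using assms not_empty by force
  have "\<bar>expectation f\<bar> \<le> (\<integral>x. \<bar>f x\<bar> \<partial>M)"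
    by (rule integral_abs_bound)
  also have "\<dots> \<le> B"
  \<comment> \<open>In the non-integrable case the Bochner integral is zero by convention, so
    \<open>0 \<le> B\<close> suffices.\<close>
  proof (cases "integrable M (\<lambda>x. \<bar>f x\<bar>)")
    case True
    then show ?thesis
      using integral_le_const[OF True] assms by auto
  qed (simp add: not_integrable_integral_eq \<open>0 \<le> B\<close>)
  finally show ?thesis .
qed

lemma (in prob_space) integrable_of_bounded:
  fixes f :: "'a \<Rightarrow> real"
  assumes "f \<in> borel_measurable M" "\<And>x. x \<in> space M \<Longrightarrow> \<bar>f x\<bar> \<le> B"
  shows "integrable M f"
  by (rule integrable_const_bound[where B=B]) (use assms in auto)

lemma tv_dist_bdd:
  assumes "prob_space \<mu>" "prob_space \<nu>"
  shows "bdd_above ((\<lambda>A. \<bar>measure \<mu> A - measure \<nu> A\<bar>) ` sets \<mu>)"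
proof (rule bdd_aboveI2)
  fix A
  have "0 \<le> measure \<mu> A" "measure \<mu> A \<le> 1" "0 \<le> measure \<nu> A" "measure \<nu> A \<le> 1"
    using assms by (auto simp: prob_space.prob_le_1)
  then show "\<bar>measure \<mu> A - measure \<nu> A\<bar> \<le> 1"
    by linarith
qed

lemma measure_diff_le_tv_dist:
  assumes "prob_space \<mu>" "prob_space \<nu>" "A \<in> sets \<mu>"
  shows "\<bar>measure \<mu> A - measure \<nu> A\<bar> \<le> tv_dist \<mu> \<nu>"
  unfolding tv_dist_def by (rule cSUP_upper[OF assms(3) tv_dist_bdd[OF assms(1,2)]])

lemma tv_dist_nonneg:
  assumes "prob_space \<mu>" "prob_space \<nu>"
  shows "0 \<le> tv_dist \<mu> \<nu>"
  using measure_diff_le_tv_dist[OF assms sets.empty_sets] by simp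

lemma tv_dist_le_1:
  assumes "prob_space \<mu>" "prob_space \<nu>"
  shows "tv_dist \<mu> \<nu> \<le> 1"
  unfolding tv_dist_def
proof (rule cSUP_least)
  fix A
  have "0 \<le> measure \<mu> A" "measure \<mu> A \<le> 1" "0 \<le> measure \<nu> A" "measure \<nu> A \<le> 1"
    using assms by (auto simp: prob_space.prob_le_1)
  then show "\<bar>measure \<mu> A - measure \<nu> A\<bar> \<le> 1"
    by linarith
qed auto

text \<open>A discretised layer-cake formula: averaging over the levels \<open>i / n\<close> writes
  \<open>f\<close>, up to \<open>1 / n\<close>, as a mean of indicators of superlevel sets, and each
  indicator contributes at most \<open>tv_dist \<mu> \<nu>\<close>. The two rounding errors vanish
  as \<open>n\<close> grows.\<close>

lemma integral_diff_le_tv_dist_unit: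
  fixes f :: "'a \<Rightarrow> real"
  assumes \<mu>: "prob_space \<mu>" and \<nu>: "prob_space \<nu>" and sets: "sets \<mu> = sets \<nu>"
    and f: "f \<in> borel_measurable \<mu>"
    and bnd: "\<And>x. x \<in> space \<mu> \<Longrightarrow> 0 \<le> f x \<and> f x \<le> 1"
  shows "\<bar>(\<integral>x. f x \<partial>\<mu>) - (\<integral>x. f x \<partial>\<nu>)\<bar> \<le> tv_dist \<mu> \<nu>"
proof -
  interpret \<mu>: prob_space \<mu> by fact
  interpret \<nu>: prob_space \<nu> by fact
  have space: "space \<mu> = space \<nu>"
    using sets by (rule sets_eq_imp_space_eq)
  note [measurable] = f
  have f'[measurable]: "f \<in> borel_measurable \<nu>"
    using f measurable_cong_sets[OF sets refl] by blast
  have int: "integrable \<mu> f" "integrable \<nu> f"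
    by (rule \<mu>.integrable_of_bounded[where B=1] \<nu>.integrable_of_bounded[where B=1];
        use bnd f f' space in force)+
  have step: "\<bar>(\<integral>x. f x \<partial>\<mu>) - (\<integral>x. f x \<partial>\<nu>)\<bar> \<le> tv_dist \<mu> \<nu> + 2 / real n" if n: "n > 0" for n :: nat
  proof -
    \<comment> \<open>\<open>h\<close> is \<open>f\<close> rounded down to a multiple of \<open>1 / n\<close>, an average of indicators of superlevel sets.\<close>
    define A where "A i = {x\<in>space \<mu>. real i \<le> real n * f x}" for i
    have A: "A i \<in> sets \<mu>" "A i \<in> sets \<nu>" for i
    proof -
      show "A i \<in> sets \<mu>"
        unfolding A_def by measurable
      then show "A i \<in> sets \<nu>"
        by (simp add: sets)
    qed
    define h where "h x = (\<Sum>i=1..n. indicator (A i) x) / real n" for x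
    have h: "\<bar>f x - h x\<bar> \<le> 1 / real n" if x: "x \<in> space \<mu>" for x
    proof -
      define m where "m = nat \<lfloor>real n * f x\<rfloor>"
      have nf: "0 \<le> real n * f x" "real n * f x \<le> real n"
        using bnd[OF x] n by (auto simp: mult_left_le)
      have m: "real m \<le> real n * f x" "real n * f x < real m + 1" "m \<le> n"
        using nf unfolding m_def by linarith+
      have "(\<Sum>i=1..n. indicator (A i) x) = real (card {i\<in>{1..n}. x \<in> A i})"
        by (simp add: indicator_def sum.If_cases Int_def)
      also have "{i\<in>{1..n}. x \<in> A i} = {1..m}"
        unfolding A_def using m x by auto
      finally have "h x = real m / real n"
        by (simp add: h_def)
      then have "f x - h x = (real n * f x - real m) / real n"
        using n by (simp add: field_simps)
      moreover have "\<bar>real n * f x - real m\<bar> \<le> 1"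
        using m by linarith
      ultimately show ?thesis
        using n by (simp add: abs_divide divide_right_mono)
    qed
    have hm: "h \<in> borel_measurable \<mu>" "h \<in> borel_measurable \<nu>"
      unfolding h_def using A by measurable
    have hi: "integrable \<mu> h" "integrable \<nu> h"
      unfolding h_def using A by (auto simp: less_top[symmetric])
    have d\<mu>: "\<bar>(\<integral>x. f x \<partial>\<mu>) - (\<integral>x. h x \<partial>\<mu>)\<bar> \<le> 1 / real n"
      using \<mu>.abs_expectation_le[of "\<lambda>x. f x - h x", OF h] int hi by simp
    have d\<nu>: "\<bar>(\<integral>x. f x \<partial>\<nu>) - (\<integral>x. h x \<partial>\<nu>)\<bar> \<le> 1 / real n"
      using \<nu>.abs_expectation_le[of "\<lambda>x. f x - h x", OF h] int hi space by simp
    have eq\<mu>: "(\<integral>x. h x \<partial>\<mu>) = (\<Sum>i=1..n. measure \<mu> (A i)) / real n"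
      unfolding h_def using A by (simp add: less_top[symmetric])
    have eq\<nu>: "(\<integral>x. h x \<partial>\<nu>) = (\<Sum>i=1..n. measure \<nu> (A i)) / real n"
      unfolding h_def using A by (simp add: less_top[symmetric])
    have "\<bar>(\<Sum>i=1..n. measure \<mu> (A i)) - (\<Sum>i=1..n. measure \<nu> (A i))\<bar>
        \<le> (\<Sum>i=1..n. \<bar>measure \<mu> (A i) - measure \<nu> (A i)\<bar>)"
      unfolding sum_subtractf[symmetric] by (rule sum_abs)
    also have "\<dots> \<le> (\<Sum>i=1..n. tv_dist \<mu> \<nu>)"
      by (intro sum_mono measure_diff_le_tv_dist \<mu> \<nu> A)
    finally have "\<bar>(\<integral>x. h x \<partial>\<mu>) - (\<integral>x. h x \<partial>\<nu>)\<bar> \<le> tv_dist \<mu> \<nu>"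
      unfolding eq\<mu> eq\<nu> diff_divide_distrib[symmetric] using n by (simp add: field_simps)
    moreover have "2 / real n = 1 / real n + 1 / real n"
      by simp
    ultimately show ?thesis
      using d\<mu> d\<nu> by linarith
  qed
  show ?thesis
  proof (rule tendsto_le[OF sequentially_bot])
    show "(\<lambda>n. tv_dist \<mu> \<nu> + 2 / real n) \<longlonglongrightarrow> tv_dist \<mu> \<nu>"
      by real_asymp
    show "\<forall>\<^sub>F n in sequentially. \<bar>(\<integral>x. f x \<partial>\<mu>) - (\<integral>x. f x \<partial>\<nu>)\<bar> \<le> tv_dist \<mu> \<nu> + 2 / real n"
      using eventually_gt_at_top[of 0] by eventually_elim (rule step)
  qed simp
qed

text \<open>The affine map \<open>(f + B) / (2 * B)\<close> carries the range into the unit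
  interval, so the factor \<open>2 * B\<close> is the length of the original range. The division
  forces \<open>B = 0\<close> to be treated apart.\<close>

lemma integral_diff_le_tv_dist:
  fixes f :: "'a \<Rightarrow> real"
  assumes \<mu>: "prob_space \<mu>" and \<nu>: "prob_space \<nu>" and sets: "sets \<mu> = sets \<nu>"
    and f: "f \<in> borel_measurable \<mu>"
    and bnd: "\<And>x. x \<in> space \<mu> \<Longrightarrow> \<bar>f x\<bar> \<le> B"
  shows "\<bar>(\<integral>x. f x \<partial>\<mu>) - (\<integral>x. f x \<partial>\<nu>)\<bar> \<le> 2 * B * tv_dist \<mu> \<nu>"
proof -
  interpret \<mu>: prob_space \<mu> by fact
  interpret \<nu>: prob_space \<nu> by fact
  have space: "space \<mu> = space \<nu>"
    using sets by (rule sets_eq_imp_space_eq)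
  have f': "f \<in> borel_measurable \<nu>"
    using f measurable_cong_sets[OF sets refl] by blast
  have int: "integrable \<mu> f" "integrable \<nu> f"
    by (rule \<mu>.integrable_of_bounded[where B=B] \<nu>.integrable_of_bounded[where B=B];
        use bnd f f' space in force)+
  have "0 \<le> B"
    using bnd \<mu>.not_empty by force
  show ?thesis
  proof (cases "B = 0")
    case True
    have "\<bar>\<integral>x. f x \<partial>\<mu>\<bar> \<le> B" "\<bar>\<integral>x. f x \<partial>\<nu>\<bar> \<le> B"
      using bnd space by (auto intro: \<mu>.abs_expectation_le \<nu>.abs_expectation_le)
    then show ?thesis
      by (simp add: True)
  next
    case False
    with \<open>0 \<le> B\<close> have B: "0 < B" by simp
    have "\<bar>(\<integral>x. (f x + B) / (2 * B) \<partial>\<mu>) - (\<integral>x. (f x + B) / (2 * B) \<partial>\<nu>)\<bar> \<le> tv_dist \<mu> \<nu>"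
    proof (rule integral_diff_le_tv_dist_unit[OF \<mu> \<nu> sets])
      fix x assume "x \<in> space \<mu>"
      from bnd[OF this] show "0 \<le> (f x + B) / (2 * B) \<and> (f x + B) / (2 * B) \<le> 1"
        using B by (auto simp: field_simps)
    qed (use f in measurable)
    also have "(\<integral>x. (f x + B) / (2 * B) \<partial>\<mu>) = ((\<integral>x. f x \<partial>\<mu>) + B) / (2 * B)"
      using int by (simp add: \<mu>.prob_space)
    also have "(\<integral>x. (f x + B) / (2 * B) \<partial>\<nu>) = ((\<integral>x. f x \<partial>\<nu>) + B) / (2 * B)"
      using int by (simp add: \<nu>.prob_space)
    also have "((\<integral>x. f x \<partial>\<mu>) + B) / (2 * B) - ((\<integral>x. f x \<partial>\<nu>) + B) / (2 * B)
        = ((\<integral>x. f x \<partial>\<mu>) - (\<integral>x. f x \<partial>\<nu>)) / (2 * B)"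
      by (simp add: diff_divide_distrib[symmetric])
    finally show ?thesis
      using B by (simp add: abs_divide divide_le_eq mult.commute)
  qed
qed

section \<open>Poisson equation of a uniformly ergodic kernel\<close>

lemma measurable_kernel_power:
  assumes K: "K \<in> E \<rightarrow>\<^sub>M prob_algebra E"
  shows "kernel_power E K n \<in> E \<rightarrow>\<^sub>M prob_algebra E"
  by (induction n) (auto intro: measurable_bind_prob_space K)

lemma kernel_prob_space:
  assumes "K \<in> E \<rightarrow>\<^sub>M prob_algebra E'" "x \<in> space E"
  shows "prob_space (K x)" "sets (K x) = sets E'" "space (K x) = space E'"
proof -
  show "prob_space (K x)" and sets: "sets (K x) = sets E'"
    using measurable_space[OF assms] by (auto simp: space_prob_algebra)
  show "space (K x) = space E'"
    using sets by (rule sets_eq_imp_space_eq)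
qed

lemma integral_kernel_measurable:
  fixes f :: "'b \<Rightarrow> real"
  assumes K: "K \<in> E \<rightarrow>\<^sub>M prob_algebra E'" and f: "f \<in> borel_measurable E'"
  shows "(\<lambda>x. \<integral>y. f y \<partial>K x) \<in> borel_measurable E"
  by (rule measurable_compose[OF measurable_prob_algebraD[OF K]]) (use f in measurable)

lemma kernel_app_measurable:
  assumes "K \<in> E \<rightarrow>\<^sub>M prob_algebra E'" "f \<in> borel_measurable E'"
  shows "kernel_app K f \<in> borel_measurable E"
  using integral_kernel_measurable[OF assms] by (simp add: kernel_app_def[abs_def])

lemma kernel_integrable:
  fixes f :: "'b \<Rightarrow> real"
  assumes K: "K \<in> E \<rightarrow>\<^sub>M prob_algebra E'" and f: "f \<in> borel_measurable E'"
    and bnd: "\<And>y. y \<in> space E' \<Longrightarrow> \<bar>f y\<bar> \<le> B" and x: "x \<in> space E"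
  shows "integrable (K x) f"
proof -
  note Kx = kernel_prob_space[OF K x]
  show ?thesis
    by (rule prob_space.integrable_of_bounded[OF Kx(1), where B=B])
       (use f bnd Kx measurable_cong_sets[OF Kx(2) refl] in auto)
qed

lemma kernel_app_bound:
  assumes K: "K \<in> E \<rightarrow>\<^sub>M prob_algebra E'"
    and bnd: "\<And>y. y \<in> space E' \<Longrightarrow> \<bar>f y\<bar> \<le> B" and x: "x \<in> space E"
  shows "\<bar>kernel_app K f x\<bar> \<le> B"
  unfolding kernel_app_def
  by (rule prob_space.abs_expectation_le[OF kernel_prob_space(1)[OF K x]])
     (simp add: kernel_prob_space[OF K x] bnd)

lemma kernel_app_cong:
  assumes K: "K \<in> E \<rightarrow>\<^sub>M prob_algebra E'" and x: "x \<in> space E"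
    and "\<And>y. y \<in> space E' \<Longrightarrow> f y = g y"
  shows "kernel_app K f x = kernel_app K g x"
  unfolding kernel_app_def
  by (rule Bochner_Integration.integral_cong) (simp_all add: kernel_prob_space[OF K x] assms(3))

lemma integral_bind_kernel:
  fixes f :: "'b \<Rightarrow> real"
  assumes \<mu>: "prob_space \<mu>" "sets \<mu> = sets E"
    and K: "K \<in> E \<rightarrow>\<^sub>M prob_algebra E'" and f: "f \<in> borel_measurable E'"
    and bnd: "\<And>y. y \<in> space E' \<Longrightarrow> \<bar>f y\<bar> \<le> B"
  shows "(\<integral>y. f y \<partial>(Giry_Monad.bind \<mu> K)) = (\<integral>x. \<integral>y. f y \<partial>K x \<partial>\<mu>)"
proof (rule integral_bind[OF f bnd, where B'=1])
  show "K \<in> \<mu> \<rightarrow>\<^sub>M subprob_algebra E'"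
    using measurable_prob_algebraD[OF K] measurable_cong_sets[OF \<mu>(2) refl] by blast
  show "finite_measure \<mu>"
    using \<mu>(1) by (simp add: prob_space_def)
  have "space \<mu> = space E"
    using \<mu>(2) by (rule sets_eq_imp_space_eq)
  then show "AE x in \<mu>. emeasure (K x) (space (K x)) \<le> ennreal 1"
    using kernel_prob_space(1)[OF K] by (intro AE_I2) (simp add: prob_space.emeasure_space_1)
qed

lemma kernel_app_power_0:
  assumes "f \<in> borel_measurable E" "x \<in> space E"
  shows "kernel_app (kernel_power E K 0) f x = f x"
  using assms by (simp add: kernel_app_def integral_return)

lemma kernel_app_power_Suc:
  assumes K: "K \<in> E \<rightarrow>\<^sub>M prob_algebra E" and f: "f \<in> borel_measurable E"
    and bnd: "\<And>y. y \<in> space E \<Longrightarrow> \<bar>f y\<bar> \<le> B" and x: "x \<in> space E"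
  shows "kernel_app (kernel_power E K (Suc n)) f x
    = kernel_app (kernel_power E K n) (kernel_app K f) x"
proof -
  note kp = kernel_prob_space[OF measurable_kernel_power[OF K, of n] x]
  show ?thesis
    using integral_bind_kernel[OF kp(1,2) K f bnd] by (simp add: kernel_app_def)
qed

text \<open>\<open>kernel_power\<close> appends the new \<open>K\<close> as the last transition, so
  on functions it produces \<open>K^n (K f)\<close>. The Poisson equation applies \<open>K\<close>
  from the outside and needs \<open>K (K^n f)\<close>. The induction generalises \<open>f\<close>
  because its step passes to \<open>kernel_app K f\<close>.\<close>

lemma kernel_app_power_commute:
  assumes K: "K \<in> E \<rightarrow>\<^sub>M prob_algebra E" and f: "f \<in> borel_measurable E"
    and bnd: "\<And>y. y \<in> space E \<Longrightarrow> \<bar>f y\<bar> \<le> B" and x: "x \<in> space E"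
  shows "kernel_app (kernel_power E K n) (kernel_app K f) x
    = kernel_app K (kernel_app (kernel_power E K n) f) x"
  using f bnd
proof (induction n arbitrary: f)
  case 0
  have "kernel_app (kernel_power E K 0) (kernel_app K f) x = kernel_app K f x"
    by (rule kernel_app_power_0[OF kernel_app_measurable[OF K 0(1)] x])
  also have "\<dots> = kernel_app K (kernel_app (kernel_power E K 0) f) x"
    by (rule kernel_app_cong[OF K x]) (rule kernel_app_power_0[OF 0(1), symmetric])
  finally show ?case .
next
  case (Suc n)
  have Kf: "kernel_app K f \<in> borel_measurable E"
    "\<And>y. y \<in> space E \<Longrightarrow> \<bar>kernel_app K f y\<bar> \<le> B"
    using kernel_app_measurable[OF K Suc.prems(1)] kernel_app_bound[OF K Suc.prems(2)] by auto
  have "kernel_app (kernel_power E K (Suc n)) (kernel_app K f) x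
      = kernel_app (kernel_power E K n) (kernel_app K (kernel_app K f)) x"
    by (rule kernel_app_power_Suc[OF K Kf x])
  also have "\<dots> = kernel_app K (kernel_app (kernel_power E K n) (kernel_app K f)) x"
    by (rule Suc.IH[OF Kf])
  also have "\<dots> = kernel_app K (kernel_app (kernel_power E K (Suc n)) f) x"
    by (rule kernel_app_cong[OF K x]) (rule kernel_app_power_Suc[OF K Suc.prems, symmetric])
  finally show ?case .
qed

section \<open>Geometric decay and control of a function by its Poisson residual\<close>

locale ergodic_kernel =
  fixes E \<pi> :: "'x measure" and K :: "'x \<Rightarrow> 'x measure" and C \<rho> :: real
  assumes prob_\<pi>: "prob_space \<pi>" and sets_\<pi>: "sets \<pi> = sets E"
    and K: "K \<in> E \<rightarrow>\<^sub>M prob_algebra E"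
    and invariant: "Giry_Monad.bind \<pi> K = \<pi>"
    and \<rho>: "0 \<le> \<rho>" "\<rho> < 1"
    and ergodic: "\<And>x k. x \<in> space E \<Longrightarrow> tv_dist (kernel_power E K k x) \<pi> \<le> C * \<rho> ^ k"
begin

sublocale \<pi>: prob_space \<pi>
  by (rule prob_\<pi>)

lemma space_\<pi>: "space \<pi> = space E"
  using sets_\<pi> by (rule sets_eq_imp_space_eq)

lemma measurable_\<pi>: "f \<in> borel_measurable E \<Longrightarrow> f \<in> borel_measurable \<pi>"
  using measurable_cong_sets[OF sets_\<pi> refl] by blast

lemma integrable_\<pi>:
  fixes f :: "'x \<Rightarrow> real"
  assumes "f \<in> borel_measurable E" "\<And>y. y \<in> space E \<Longrightarrow> \<bar>f y\<bar> \<le> B"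
  shows "integrable \<pi> f"
  by (rule \<pi>.integrable_of_bounded[where B=B]) (use assms measurable_\<pi> space_\<pi> in auto)

text \<open>The ergodicity bound at \<open>k = 0\<close> places \<open>C\<close> above a total
  variation distance.\<close>

lemma C_nonneg: "0 \<le> C"
proof -
  obtain x where x: "x \<in> space E"
    using \<pi>.not_empty space_\<pi> by blast
  have "0 \<le> tv_dist (kernel_power E K 0 x) \<pi>"
    by (rule tv_dist_nonneg[OF kernel_prob_space(1)[OF measurable_kernel_power[OF K] x] prob_\<pi>])
  also have "\<dots> \<le> C * \<rho> ^ 0"
    by (rule ergodic[OF x])
  finally show ?thesis
    by simp
qed

context
  fixes f :: "'x \<Rightarrow> real" and B :: real
  assumes f: "f \<in> borel_measurable E" and f_bound: "\<And>y. y \<in> space E \<Longrightarrow> \<bar>f y\<bar> \<le> B"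
begin

lemma bound_nonneg: "0 \<le> B"
  using \<pi>.not_empty space_\<pi> f_bound by force

lemma kernel_power_decay:
  assumes x: "x \<in> space E"
  shows "\<bar>kernel_app (kernel_power E K n) f x - (\<integral>y. f y \<partial>\<pi>)\<bar> \<le> 2 * B * C * \<rho> ^ n"
proof -
  note kp = kernel_prob_space[OF measurable_kernel_power[OF K, of n] x]
  have "\<bar>kernel_app (kernel_power E K n) f x - (\<integral>y. f y \<partial>\<pi>)\<bar>
      \<le> 2 * B * tv_dist (kernel_power E K n x) \<pi>"
    unfolding kernel_app_def
    by (rule integral_diff_le_tv_dist[OF kp(1) prob_\<pi>])
       (use kp sets_\<pi> f f_bound measurable_cong_sets[OF kp(2) refl] in auto)
  also have "\<dots> \<le> 2 * B * (C * \<rho> ^ n)"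
    using ergodic[OF x] bound_nonneg by (intro mult_left_mono) auto
  finally show ?thesis
    by (simp add: mult.assoc)
qed

lemma integral_kernel_app_invariant: "(\<integral>x. kernel_app K f x \<partial>\<pi>) = (\<integral>x. f x \<partial>\<pi>)"
  using integral_bind_kernel[OF prob_\<pi> sets_\<pi> K f f_bound] invariant by (simp add: kernel_app_def)

end

lemma integral_kernel_power_invariant:
  assumes "f \<in> borel_measurable E" "\<And>y. y \<in> space E \<Longrightarrow> \<bar>f y\<bar> \<le> B"
  shows "(\<integral>x. kernel_app (kernel_power E K n) f x \<partial>\<pi>) = (\<integral>x. f x \<partial>\<pi>)"
  using assms
proof (induction n arbitrary: f)
  case 0
  then show ?case
    by (intro Bochner_Integration.integral_cong)
       (simp_all add: space_\<pi> kernel_app_power_0 del: kernel_power.simps)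
next
  case (Suc n)
  have "(\<integral>x. kernel_app (kernel_power E K (Suc n)) f x \<partial>\<pi>)
      = (\<integral>x. kernel_app (kernel_power E K n) (kernel_app K f) x \<partial>\<pi>)"
    by (intro Bochner_Integration.integral_cong refl kernel_app_power_Suc[OF K Suc.prems])
       (simp_all add: space_\<pi>)
  also have "\<dots> = (\<integral>x. kernel_app K f x \<partial>\<pi>)"
    by (rule Suc.IH) (use kernel_app_measurable[OF K] kernel_app_bound[OF K] Suc.prems in auto)
  also have "\<dots> = (\<integral>x. f x \<partial>\<pi>)"
    by (rule integral_kernel_app_invariant[OF Suc.prems])
  finally show ?case .
qed

text \<open>Iterating \<open>h = \<psi> + K h\<close> gives \<open>h\<close> as the sum of
  \<open>K^j \<psi>\<close> for \<open>j < n\<close> plus \<open>K^n h\<close>. Invariance makes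
  \<open>\<psi>\<close> of mean zero, so the terms are at most \<open>2 * D * C * \<rho>^j\<close>
  and sum geometrically. The a priori bound \<open>A\<close> enters only through
  \<open>K^n h\<close>, which tends to zero; the resulting estimate is thus linear in
  \<open>D\<close>.\<close>

lemma bound_by_poisson_residual:
  assumes h: "h \<in> borel_measurable E" "\<And>y. y \<in> space E \<Longrightarrow> \<bar>h y\<bar> \<le> A" "(\<integral>y. h y \<partial>\<pi>) = 0"
    and residual: "\<And>y. y \<in> space E \<Longrightarrow> \<bar>h y - kernel_app K h y\<bar> \<le> D"
    and x: "x \<in> space E"
  shows "\<bar>h x\<bar> \<le> 2 * C * D / (1 - \<rho>)"
proof -
  define \<psi> where "\<psi> y = h y - kernel_app K h y" for y
  note Kh = kernel_app_measurable[OF K h(1)] kernel_app_bound[OF K h(2)]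
  have \<psi>: "\<psi> \<in> borel_measurable E" "\<And>y. y \<in> space E \<Longrightarrow> \<bar>\<psi> y\<bar> \<le> D"
    unfolding \<psi>_def using h(1) Kh(1) residual by auto
  have D: "0 \<le> D"
    by (rule bound_nonneg[OF \<psi>])
  have "(\<integral>y. \<psi> y \<partial>\<pi>) = 0"
    unfolding \<psi>_def using integrable_\<pi>[OF h(1,2)] integrable_\<pi>[OF Kh]
    by (simp add: integral_kernel_app_invariant[OF h(1,2)] h(3))
  then have \<psi>_decay: "\<bar>kernel_app (kernel_power E K j) \<psi> x\<bar> \<le> 2 * D * C * \<rho> ^ j" for j
    using kernel_power_decay[OF \<psi> x, of j] by simp
  have telescope: "h x = (\<Sum>j<n. kernel_app (kernel_power E K j) \<psi> x)
      + kernel_app (kernel_power E K n) h x" for n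
  proof (induction n)
    case 0
    then show ?case
      using h(1) x by (simp add: kernel_app_power_0 del: kernel_power.simps)
  next
    case (Suc n)
    note kp = measurable_kernel_power[OF K, of n]
    have "kernel_app (kernel_power E K n) \<psi> x
      = kernel_app (kernel_power E K n) h x - kernel_app (kernel_power E K (Suc n)) h x"
      using kernel_integrable[OF kp h(1,2) x] kernel_integrable[OF kp Kh x]
      by (simp add: \<psi>_def kernel_app_def[of "kernel_power E K n"]
          kernel_app_power_Suc[OF K h(1,2) x] del: kernel_power.simps)
    then show ?case
      using Suc.IH by simp
  qed
  have "\<bar>h x\<bar> \<le> 2 * D * C / (1 - \<rho>) + 2 * A * C * \<rho> ^ n" for n
  proof -
    have "\<bar>\<Sum>j<n. kernel_app (kernel_power E K j) \<psi> x\<bar> \<le> (\<Sum>j<n. 2 * D * C * \<rho> ^ j)"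
      by (rule order_trans[OF sum_abs sum_mono]) (rule \<psi>_decay)
    also have "\<dots> = 2 * D * C * ((1 - \<rho> ^ n) / (1 - \<rho>))"
      using \<rho> by (simp add: sum_distrib_left[symmetric] sum_gp_strict)
    also have "\<dots> \<le> 2 * D * C * (1 / (1 - \<rho>))"
      using \<rho> D C_nonneg by (intro mult_left_mono divide_right_mono) auto
    finally have "\<bar>\<Sum>j<n. kernel_app (kernel_power E K j) \<psi> x\<bar> \<le> 2 * D * C / (1 - \<rho>)"
      by simp
    moreover have "\<bar>kernel_app (kernel_power E K n) h x\<bar> \<le> 2 * A * C * \<rho> ^ n"
      using kernel_power_decay[OF h(1,2) x, of n] h(3) by simp
    ultimately show ?thesis
      using telescope[of n] by linarith
  qed
  moreover have "(\<lambda>n. 2 * D * C / (1 - \<rho>) + 2 * A * C * \<rho> ^ n)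
      \<longlonglongrightarrow> 2 * D * C / (1 - \<rho>) + 2 * A * C * 0"
    using \<rho> by (intro tendsto_intros LIMSEQ_power_zero) auto
  ultimately have "\<bar>h x\<bar> \<le> 2 * D * C / (1 - \<rho>) + 2 * A * C * 0"
    by (intro LIMSEQ_le_const) auto
  then show ?thesis
    by (simp add: mult_ac)
qed

section \<open>The series solution of the Poisson equation\<close>

context
  fixes f :: "'x \<Rightarrow> real" and B :: real
  assumes f: "f \<in> borel_measurable E" and f_bound: "\<And>y. y \<in> space E \<Longrightarrow> \<bar>f y\<bar> \<le> B"
begin

abbreviation "fc \<equiv> \<lambda>y. f y - (\<integral>z. f z \<partial>\<pi>)"

lemma centred_measurable: "fc \<in> borel_measurable E"
  using f by measurable

lemma centred_bound: "y \<in> space E \<Longrightarrow> \<bar>fc y\<bar> \<le> 2 * B"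
  using f_bound[of y] \<pi>.abs_expectation_le[of f B] f_bound space_\<pi> by fastforce

lemma integral_centred: "(\<integral>y. fc y \<partial>\<pi>) = 0"
  using integrable_\<pi>[OF f f_bound] by (simp add: \<pi>.prob_space)

text \<open>The constant 4 arises from two doublings: centring raises the bound of \<open>f\<close>
  to \<open>2 * B\<close>, and \<open>kernel_power_decay\<close> contributes another factor 2. The
  mean subtracted there is zero for \<open>fc\<close>.\<close>

lemma centred_decay:
  "x \<in> space E \<Longrightarrow> \<bar>kernel_app (kernel_power E K n) fc x\<bar> \<le> 4 * B * C * \<rho> ^ n"
  using kernel_power_decay[OF centred_measurable centred_bound, of x n] integral_centred
  by (simp add: mult.assoc)

lemma summable_geometric_bound: "summable (\<lambda>n. 4 * B * C * \<rho> ^ n)"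
  using \<rho> by (intro summable_mult summable_geometric) auto

lemma summable_centred:
  "x \<in> space E \<Longrightarrow> summable (\<lambda>n. \<bar>kernel_app (kernel_power E K n) fc x\<bar>)"
  by (rule summable_comparison_test'[OF summable_geometric_bound, of 0]) (simp add: centred_decay)

lemma poisson_sol_measurable: "poisson_sol E \<pi> K f \<in> borel_measurable E"
  unfolding poisson_sol_def[abs_def]
  by (intro borel_measurable_suminf kernel_app_measurable[OF measurable_kernel_power[OF K]]
      centred_measurable)

lemma poisson_sol_bound:
  assumes x: "x \<in> space E"
  shows "\<bar>poisson_sol E \<pi> K f x\<bar> \<le> 4 * B * C / (1 - \<rho>)"
proof -
  have "\<bar>poisson_sol E \<pi> K f x\<bar> \<le> (\<Sum>n. \<bar>kernel_app (kernel_power E K n) fc x\<bar>)"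
    unfolding poisson_sol_def by (rule summable_rabs[OF summable_centred[OF x]])
  also have "\<dots> \<le> (\<Sum>n. 4 * B * C * \<rho> ^ n)"
    by (rule suminf_le[OF centred_decay[OF x] summable_centred[OF x] summable_geometric_bound])
  also have "\<dots> = 4 * B * C * (1 / (1 - \<rho>))"
    using \<rho> by (subst suminf_mult) (simp_all add: suminf_geometric summable_geometric)
  finally show ?thesis
    by simp
qed

text \<open>Geometric domination permits the interchange of sum and integral. The measure is kept
  general for two uses: \<open>\<mu> = \<pi>\<close> yields the mean of the solution, and
  \<open>\<mu> = K x\<close> yields \<open>K\<close> applied to it.\<close>

lemma integral_poisson_sol_eq:
  assumes \<mu>: "prob_space \<mu>" "sets \<mu> = sets E"
  shows "(\<integral>x. poisson_sol E \<pi> K f x \<partial>\<mu>)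
    = (\<Sum>n. \<integral>x. kernel_app (kernel_power E K n) fc x \<partial>\<mu>)"
  unfolding poisson_sol_def[abs_def]
proof (rule integral_suminf)
  interpret \<mu>: prob_space \<mu> by fact
  have space: "space \<mu> = space E"
    using \<mu>(2) by (rule sets_eq_imp_space_eq)
  have m: "kernel_app (kernel_power E K n) fc \<in> borel_measurable \<mu>" for n
    using kernel_app_measurable[OF measurable_kernel_power[OF K] centred_measurable]
      measurable_cong_sets[OF \<mu>(2) refl] by blast
  show int: "integrable \<mu> (kernel_app (kernel_power E K n) fc)" for n
    by (rule \<mu>.integrable_of_bounded[OF m]) (rule centred_decay, simp add: space)
  show "AE x in \<mu>. summable (\<lambda>n. norm (kernel_app (kernel_power E K n) fc x))"
    using summable_centred by (intro AE_I2) (simp add: space)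
  show "summable (\<lambda>n. \<integral>x. norm (kernel_app (kernel_power E K n) fc x) \<partial>\<mu>)"
  proof (rule summable_comparison_test'[OF summable_geometric_bound, of 0])
    show "norm (\<integral>x. norm (kernel_app (kernel_power E K n) fc x) \<partial>\<mu>) \<le> 4 * B * C * \<rho> ^ n" for n
      using \<mu>.abs_expectation_le[of "\<lambda>x. \<bar>kernel_app (kernel_power E K n) fc x\<bar>"]
      by (simp add: space centred_decay)
  qed
qed

text \<open>Every term of the series has mean zero by invariance. This common normalisation is what
  lets solutions for two different kernels be compared by
  \<open>bound_by_poisson_residual\<close>.\<close>

lemma integral_poisson_sol: "(\<integral>x. poisson_sol E \<pi> K f x \<partial>\<pi>) = 0"
  using integral_poisson_sol_eq[OF prob_\<pi> sets_\<pi>] integral_centred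
  by (simp add: integral_kernel_power_invariant[OF centred_measurable centred_bound])

text \<open>Applying \<open>K\<close> shifts the series by one index, so the difference is its
  zeroth term.\<close>

lemma poisson_equation:
  assumes x: "x \<in> space E"
  shows "poisson_sol E \<pi> K f x - kernel_app K (poisson_sol E \<pi> K f) x = fc x"
proof -
  note Kx = kernel_prob_space[OF K x]
  have "kernel_app K (poisson_sol E \<pi> K f) x
      = (\<Sum>n. kernel_app K (kernel_app (kernel_power E K n) fc) x)"
    unfolding kernel_app_def[of K] by (rule integral_poisson_sol_eq[OF Kx(1,2)])
  also have "\<dots> = (\<Sum>n. kernel_app (kernel_power E K (Suc n)) fc x)"
    by (simp add: kernel_app_power_Suc[OF K centred_measurable centred_bound x]
        kernel_app_power_commute[OF K centred_measurable centred_bound x] del: kernel_power.simps)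
  also have "\<dots> = poisson_sol E \<pi> K f x - kernel_app (kernel_power E K 0) fc x"
    unfolding poisson_sol_def
    by (rule suminf_split_head[OF summable_rabs_cancel[OF summable_centred[OF x]]])
  finally show ?thesis
    using kernel_app_power_0[OF centred_measurable x] by simp
qed

end

end

lemma poisson_sol_lipschitz:
  assumes K1: "ergodic_kernel E \<pi> K1 C \<rho>" and K2: "ergodic_kernel E \<pi> K2 C \<rho>"
    and f: "f \<in> borel_measurable E" "\<And>y. y \<in> space E \<Longrightarrow> \<bar>f y\<bar> \<le> B"
    and \<delta>: "\<And>y. y \<in> space E \<Longrightarrow> tv_dist (K1 y) (K2 y) \<le> \<delta>"
    and x: "x \<in> space E"
  shows "\<bar>poisson_sol E \<pi> K1 f x - poisson_sol E \<pi> K2 f x\<bar>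
    \<le> 2 * C * (2 * (4 * B * C / (1 - \<rho>)) * \<delta>) / (1 - \<rho>)"
proof -
  interpret K1: ergodic_kernel E \<pi> K1 C \<rho> by fact
  interpret K2: ergodic_kernel E \<pi> K2 C \<rho> by fact
  let ?g1 = "poisson_sol E \<pi> K1 f" and ?g2 = "poisson_sol E \<pi> K2 f"
  let ?G = "4 * B * C / (1 - \<rho>)"
  note m1 = K1.poisson_sol_measurable[OF f] and m2 = K2.poisson_sol_measurable[OF f]
  have b1: "\<And>y. y \<in> space E \<Longrightarrow> \<bar>?g1 y\<bar> \<le> ?G"
    by (rule K1.poisson_sol_bound[OF f])
  have b2: "\<And>y. y \<in> space E \<Longrightarrow> \<bar>?g2 y\<bar> \<le> ?G"
    by (rule K2.poisson_sol_bound[OF f])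
  show ?thesis
  \<comment> \<open>The value \<open>?G + ?G\<close> is a crude a priori bound for the difference;
    it does not appear in the conclusion.\<close>
  proof (rule K1.bound_by_poisson_residual[where A="?G + ?G", OF _ _ _ _ x])
    show "(\<lambda>y. ?g1 y - ?g2 y) \<in> borel_measurable E"
      using m1 m2 by measurable
    show "\<bar>?g1 y - ?g2 y\<bar> \<le> ?G + ?G" if "y \<in> space E" for y
      using b1[OF that] b2[OF that] by linarith
    show "(\<integral>y. ?g1 y - ?g2 y \<partial>\<pi>) = 0"
      using K1.integrable_\<pi>[OF m1 b1] K1.integrable_\<pi>[OF m2 b2]
      by (simp add: K1.integral_poisson_sol[OF f] K2.integral_poisson_sol[OF f])
    fix y assume y: "y \<in> space E"
    note k1 = kernel_prob_space[OF K1.K y] and k2 = kernel_prob_space[OF K2.K y]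
    have "kernel_app K1 (\<lambda>y. ?g1 y - ?g2 y) y = kernel_app K1 ?g1 y - kernel_app K1 ?g2 y"
      using kernel_integrable[OF K1.K m1 b1 y] kernel_integrable[OF K1.K m2 b2 y]
      by (simp add: kernel_app_def)
    \<comment> \<open>Both Poisson equations have the same right-hand side, because both kernels
      leave \<open>\<pi>\<close> invariant. Subtracting them leaves only the two kernels acting on
      the one function \<open>?g2\<close>.\<close>
    then have "?g1 y - ?g2 y - kernel_app K1 (\<lambda>y. ?g1 y - ?g2 y) y
        = kernel_app K1 ?g2 y - kernel_app K2 ?g2 y"
      using K1.poisson_equation[OF f y] K2.poisson_equation[OF f y] by simp
    also have "\<bar>\<dots>\<bar> \<le> 2 * ?G * tv_dist (K1 y) (K2 y)"
      unfolding kernel_app_def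
      by (rule integral_diff_le_tv_dist[OF k1(1) k2(1)])
         (use k1 k2 m2 b2 measurable_cong_sets[OF k1(2) refl] in auto)
    also have "\<dots> \<le> 2 * ?G * \<delta>"
      using \<delta>[OF y] b1[OF y] by (intro mult_left_mono) auto
    finally show "\<bar>?g1 y - ?g2 y - kernel_app K1 (\<lambda>y. ?g1 y - ?g2 y) y\<bar> \<le> 2 * ?G * \<delta>" .
  qed
qed

section \<open>Convergence in probability\<close>

lemma tendsto_in_probD:
  "tendsto_in_prob M Y c \<Longrightarrow> 0 < \<epsilon> \<Longrightarrow>
    (\<lambda>n. measure M {\<omega>\<in>space M. \<epsilon> < \<bar>Y n \<omega> - c\<bar>}) \<longlonglongrightarrow> 0"
  by (simp add: tendsto_in_prob_def)

context prob_space
begin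

text \<open>The bound is asked for \<open>0 < n\<close> only, because an average over an empty range
  has the default value 0 and the decomposition of averages used later fails there.\<close>

lemma tendsto_in_prob_dominated:
  assumes Z: "\<And>n. Z n \<in> borel_measurable M" "tendsto_in_prob M Z 0"
    and bound: "\<And>n \<omega>. 0 < n \<Longrightarrow> \<omega> \<in> space M \<Longrightarrow> \<bar>Y n \<omega> - c\<bar> \<le> \<bar>Z n \<omega>\<bar>"
  shows "tendsto_in_prob M Y c"
  unfolding tendsto_in_prob_def
proof (intro allI impI)
  fix \<epsilon> :: real assume \<epsilon>: "0 < \<epsilon>"
  note [measurable] = Z(1)
  show "(\<lambda>n. prob {\<omega>\<in>space M. \<epsilon> < \<bar>Y n \<omega> - c\<bar>}) \<longlonglongrightarrow> 0"
  proof (rule tendsto_sandwich[OF _ _ tendsto_const])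
    show "(\<lambda>n. prob {\<omega>\<in>space M. \<epsilon> < \<bar>Z n \<omega> - 0\<bar>}) \<longlonglongrightarrow> 0"
      by (rule tendsto_in_probD[OF Z(2) \<epsilon>])
    show "\<forall>\<^sub>F n in sequentially. prob {\<omega>\<in>space M. \<epsilon> < \<bar>Y n \<omega> - c\<bar>}
        \<le> prob {\<omega>\<in>space M. \<epsilon> < \<bar>Z n \<omega> - 0\<bar>}"
      using eventually_gt_at_top[of 0]
    proof eventually_elim
      case (elim n)
      have "{\<omega>\<in>space M. \<epsilon> < \<bar>Y n \<omega> - c\<bar>} \<subseteq> {\<omega>\<in>space M. \<epsilon> < \<bar>Z n \<omega> - 0\<bar>}"
        using bound[OF elim] by (auto intro: less_le_trans)
      then show ?case
        by (rule finite_measure_mono) measurable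
    qed
  qed simp
qed

lemma tendsto_in_prob_isCont:
  assumes Y: "\<And>n. Y n \<in> borel_measurable M" "tendsto_in_prob M Y c"
    and f: "isCont f c"
  shows "tendsto_in_prob M (\<lambda>n \<omega>. f (Y n \<omega>)) (f c)"
  unfolding tendsto_in_prob_def
proof (intro allI impI)
  fix \<epsilon> :: real assume \<epsilon>: "0 < \<epsilon>"
  note [measurable] = Y(1)
  from f \<epsilon> obtain \<delta> where \<delta>: "0 < \<delta>" "\<And>x. \<bar>x - c\<bar> < \<delta> \<Longrightarrow> \<bar>f x - f c\<bar> < \<epsilon>"
    unfolding continuous_at_eps_delta dist_real_def by blast
  show "(\<lambda>n. prob {\<omega>\<in>space M. \<epsilon> < \<bar>f (Y n \<omega>) - f c\<bar>}) \<longlonglongrightarrow> 0"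
  proof (rule tendsto_sandwich[OF _ _ tendsto_const])
    \<comment> \<open>The events of \<open>tendsto_in_prob\<close> are strict, while continuity only
      excludes \<open>\<bar>Y n \<omega> - c\<bar> < \<delta>\<close>. Halving
      \<open>\<delta>\<close> restores strictness.\<close>
    show "(\<lambda>n. prob {\<omega>\<in>space M. \<delta> / 2 < \<bar>Y n \<omega> - c\<bar>}) \<longlonglongrightarrow> 0"
      using \<delta>(1) by (intro tendsto_in_probD[OF Y(2)]) simp
    have "{\<omega>\<in>space M. \<epsilon> < \<bar>f (Y n \<omega>) - f c\<bar>} \<subseteq> {\<omega>\<in>space M. \<delta> / 2 < \<bar>Y n \<omega> - c\<bar>}" for n
    proof safe
      fix \<omega> assume "\<epsilon> < \<bar>f (Y n \<omega>) - f c\<bar>"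
      then have "\<delta> \<le> \<bar>Y n \<omega> - c\<bar>"
        using \<delta>(2)[of "Y n \<omega>"] by linarith
      then show "\<delta> / 2 < \<bar>Y n \<omega> - c\<bar>"
        using \<delta>(1) by linarith
    qed
    then show "\<forall>\<^sub>F n in sequentially. prob {\<omega>\<in>space M. \<epsilon> < \<bar>f (Y n \<omega>) - f c\<bar>}
        \<le> prob {\<omega>\<in>space M. \<delta> / 2 < \<bar>Y n \<omega> - c\<bar>}"
      by (intro always_eventually allI finite_measure_mono) auto
  qed simp
qed

lemma tendsto_in_prob_add:
  assumes Y: "\<And>n. Y n \<in> borel_measurable M" "tendsto_in_prob M Y a"
    and Z: "\<And>n. Z n \<in> borel_measurable M" "tendsto_in_prob M Z b"
  shows "tendsto_in_prob M (\<lambda>n \<omega>. Y n \<omega> + Z n \<omega>) (a + b)"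
  unfolding tendsto_in_prob_def
proof (intro allI impI)
  fix \<epsilon> :: real assume \<epsilon>: "0 < \<epsilon>"
  note [measurable] = Y(1) Z(1)
  let ?A = "\<lambda>n. {\<omega>\<in>space M. \<epsilon> / 2 < \<bar>Y n \<omega> - a\<bar>}"
  let ?B = "\<lambda>n. {\<omega>\<in>space M. \<epsilon> / 2 < \<bar>Z n \<omega> - b\<bar>}"
  show "(\<lambda>n. prob {\<omega>\<in>space M. \<epsilon> < \<bar>Y n \<omega> + Z n \<omega> - (a + b)\<bar>}) \<longlonglongrightarrow> 0"
  proof (rule tendsto_sandwich[OF _ _ tendsto_const])
    have "(\<lambda>n. prob (?A n) + prob (?B n)) \<longlonglongrightarrow> 0 + 0"
      using \<epsilon> by (intro tendsto_add tendsto_in_probD[OF Y(2)] tendsto_in_probD[OF Z(2)]) simp_all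
    then show "(\<lambda>n. prob (?A n) + prob (?B n)) \<longlonglongrightarrow> 0"
      by simp
    have "prob {\<omega>\<in>space M. \<epsilon> < \<bar>Y n \<omega> + Z n \<omega> - (a + b)\<bar>} \<le> prob (?A n) + prob (?B n)" for n
    proof -
      have "prob {\<omega>\<in>space M. \<epsilon> < \<bar>Y n \<omega> + Z n \<omega> - (a + b)\<bar>} \<le> prob (?A n \<union> ?B n)"
      proof (rule finite_measure_mono)
        show "{\<omega>\<in>space M. \<epsilon> < \<bar>Y n \<omega> + Z n \<omega> - (a + b)\<bar>} \<subseteq> ?A n \<union> ?B n"
        proof
          fix \<omega> assume "\<omega> \<in> {\<omega>\<in>space M. \<epsilon> < \<bar>Y n \<omega> + Z n \<omega> - (a + b)\<bar>}"
          then show "\<omega> \<in> ?A n \<union> ?B n"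
            by simp argo
        qed
      qed measurable
      also have "\<dots> \<le> prob (?A n) + prob (?B n)"
        by (rule measure_Un_le) measurable
      finally show ?thesis .
    qed
    then show "\<forall>\<^sub>F n in sequentially. prob {\<omega>\<in>space M. \<epsilon> < \<bar>Y n \<omega> + Z n \<omega> - (a + b)\<bar>}
        \<le> prob (?A n) + prob (?B n)"
      by (rule always_eventually[OF allI])
  qed simp
qed

text \<open>Along almost every path the indicator of the exceptional event is eventually zero, so
  dominated convergence applies to its expectation.\<close>

lemma AE_imp_tendsto_in_prob:
  assumes Y: "\<And>n. Y n \<in> borel_measurable M" and conv: "AE \<omega> in M. (\<lambda>n. Y n \<omega>) \<longlonglongrightarrow> c"
  shows "tendsto_in_prob M Y c"
  unfolding tendsto_in_prob_def
proof (intro allI impI)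
  fix \<epsilon> :: real assume \<epsilon>: "0 < \<epsilon>"
  note [measurable] = Y
  let ?A = "\<lambda>n. {\<omega>\<in>space M. \<epsilon> < \<bar>Y n \<omega> - c\<bar>}"
  have "(\<lambda>n. \<integral>\<omega>. indicator (?A n) \<omega> \<partial>M) \<longlonglongrightarrow> (\<integral>\<omega>. (0::real) \<partial>M)"
  proof (rule integral_dominated_convergence[where w="\<lambda>_. 1"])
    show "AE \<omega> in M. (\<lambda>n. indicator (?A n) \<omega>) \<longlonglongrightarrow> (0::real)"
      using conv
    proof eventually_elim
      fix \<omega> assume "(\<lambda>n. Y n \<omega>) \<longlonglongrightarrow> c"
      then have "\<forall>\<^sub>F n in sequentially. dist (Y n \<omega>) c < \<epsilon>"
        using \<epsilon> by (rule tendstoD)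
      then have "\<forall>\<^sub>F n in sequentially. indicator (?A n) \<omega> = (0::real)"
        by eventually_elim (auto simp: dist_real_def)
      then show "(\<lambda>n. indicator (?A n) \<omega>) \<longlonglongrightarrow> (0::real)"
        by (rule tendsto_eventually)
    qed
  qed (auto simp: indicator_def)
  then show "(\<lambda>n. prob (?A n)) \<longlonglongrightarrow> 0"
    by simp
qed

text \<open>Bounded convergence in probability: the integrand is at most \<open>r / 2\<close> off
  the exceptional event and at most \<open>B\<close> on it, and that event has vanishing
  probability.\<close>

lemma tendsto_in_prob_imp_expectation:
  assumes Y: "\<And>n. Y n \<in> borel_measurable M" "tendsto_in_prob M Y 0"
    and bound: "\<And>\<omega>. \<omega> \<in> space M \<Longrightarrow> \<forall>n. \<bar>Y n \<omega>\<bar> \<le> B"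
  shows "(\<lambda>n. expectation (\<lambda>\<omega>. \<bar>Y n \<omega>\<bar>)) \<longlonglongrightarrow> 0"
proof (rule LIMSEQ_I)
  note [measurable] = Y(1)
  fix r :: real assume r: "0 < r"
  have B: "0 \<le> B"
    using bound not_empty by force
  let ?A = "\<lambda>n. {\<omega>\<in>space M. r / 2 < \<bar>Y n \<omega> - 0\<bar>}"
  have le: "expectation (\<lambda>\<omega>. \<bar>Y n \<omega>\<bar>) \<le> r / 2 + B * prob (?A n)" for n
  proof -
    have "expectation (\<lambda>\<omega>. \<bar>Y n \<omega>\<bar>) \<le> expectation (\<lambda>\<omega>. r / 2 + B * indicator (?A n) \<omega>)"
    proof (rule integral_mono)
      show "integrable M (\<lambda>\<omega>. \<bar>Y n \<omega>\<bar>)"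
        by (rule integrable_of_bounded[where B=B]) (use bound in auto)
      show "integrable M (\<lambda>\<omega>. r / 2 + B * indicator (?A n) \<omega>)"
        by (intro Bochner_Integration.integrable_add integrable_mult_right) (auto simp: less_top[symmetric])
      show "\<bar>Y n \<omega>\<bar> \<le> r / 2 + B * indicator (?A n) \<omega>" if "\<omega> \<in> space M" for \<omega>
        using bound[OF that] r B that by (cases "\<omega> \<in> ?A n") (auto intro: add_increasing)
    qed
    also have "\<dots> = r / 2 + B * prob (?A n)"
      by (subst Bochner_Integration.integral_add) (auto simp: prob_space less_top[symmetric])
    finally show ?thesis .
  qed
  have "(\<lambda>n. B * prob (?A n)) \<longlonglongrightarrow> B * 0"
    using r by (intro tendsto_mult tendsto_const tendsto_in_probD[OF Y(2)]) simp
  then have "\<forall>\<^sub>F n in sequentially. B * prob (?A n) < r / 2"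
    using r by (intro order_tendstoD(2)) auto
  then obtain N where N: "\<And>n. N \<le> n \<Longrightarrow> B * prob (?A n) < r / 2"
    unfolding eventually_sequentially by blast
  show "\<exists>N. \<forall>n\<ge>N. norm (expectation (\<lambda>\<omega>. \<bar>Y n \<omega>\<bar>) - 0) < r"
  proof (intro exI allI impI)
    fix n assume "N \<le> n"
    have "0 \<le> expectation (\<lambda>\<omega>. \<bar>Y n \<omega>\<bar>)"
      by (rule Bochner_Integration.integral_nonneg) simp
    then show "norm (expectation (\<lambda>\<omega>. \<bar>Y n \<omega>\<bar>) - 0) < r"
      using le[of n] N[OF \<open>N \<le> n\<close>] by simp
  qed
qed

lemma second_moment_imp_tendsto_in_prob:
  assumes Y: "\<And>n. Y n \<in> borel_measurable M" "\<And>n. integrable M (\<lambda>\<omega>. (Y n \<omega>)\<^sup>2)"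
    and conv: "(\<lambda>n. expectation (\<lambda>\<omega>. (Y n \<omega>)\<^sup>2)) \<longlonglongrightarrow> 0"
  shows "tendsto_in_prob M Y 0"
  unfolding tendsto_in_prob_def
proof (intro allI impI)
  fix \<epsilon> :: real assume \<epsilon>: "0 < \<epsilon>"
  note [measurable] = Y(1)
  show "(\<lambda>n. prob {\<omega>\<in>space M. \<epsilon> < \<bar>Y n \<omega> - 0\<bar>}) \<longlonglongrightarrow> 0"
  proof (rule tendsto_sandwich[OF _ _ tendsto_const])
    have "(\<lambda>n. expectation (\<lambda>\<omega>. (Y n \<omega>)\<^sup>2) / \<epsilon>\<^sup>2) \<longlonglongrightarrow> 0 / \<epsilon>\<^sup>2"
      using conv \<epsilon> by (intro tendsto_divide) auto
    then show "(\<lambda>n. expectation (\<lambda>\<omega>. (Y n \<omega>)\<^sup>2) / \<epsilon>\<^sup>2) \<longlonglongrightarrow> 0"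
      by simp
    have "prob {\<omega>\<in>space M. \<epsilon> < \<bar>Y n \<omega> - 0\<bar>} \<le> expectation (\<lambda>\<omega>. (Y n \<omega>)\<^sup>2) / \<epsilon>\<^sup>2" for n
    proof -
      have "prob {\<omega>\<in>space M. \<epsilon> < \<bar>Y n \<omega> - 0\<bar>} \<le> prob {\<omega>\<in>space M. \<epsilon>\<^sup>2 \<le> (Y n \<omega>)\<^sup>2}"
        using \<epsilon> by (intro finite_measure_mono) (auto simp: abs_le_square_iff[symmetric])
      also have "\<dots> \<le> expectation (\<lambda>\<omega>. (Y n \<omega>)\<^sup>2) / \<epsilon>\<^sup>2"
        by (rule integral_Markov_inequality_measure[OF Y(2) sets.empty_sets]) (use \<epsilon> in auto)
      finally show ?thesis .
    qed
    then show "\<forall>\<^sub>F n in sequentially. prob {\<omega>\<in>space M. \<epsilon> < \<bar>Y n \<omega> - 0\<bar>}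
        \<le> expectation (\<lambda>\<omega>. (Y n \<omega>)\<^sup>2) / \<epsilon>\<^sup>2"
      by (rule always_eventually[OF allI])
  qed simp
qed

text \<open>Slutsky's theorem at the level of characteristic functions. Factoring out a term of
  modulus one turns the difference of exponentials into a bounded continuous function of
  \<open>Y n - Z n\<close> that vanishes at 0.\<close>

lemma expectation_iexp_diff_tendsto_0:
  assumes Y[measurable]: "\<And>n. Y n \<in> borel_measurable M" and Z[measurable]: "\<And>n. Z n \<in> borel_measurable M"
    and conv: "tendsto_in_prob M (\<lambda>n \<omega>. Y n \<omega> - Z n \<omega>) 0"
  shows "(\<lambda>n. (CLINT \<omega>|M. iexp (t * Y n \<omega>)) - (CLINT \<omega>|M. iexp (t * Z n \<omega>))) \<longlonglongrightarrow> 0"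
proof -
  let ?f = "\<lambda>x. cmod (iexp (t * x) - 1)"
  have "isCont ?f 0"
    by (intro continuous_intros)
  from tendsto_in_prob_isCont[OF _ conv this]
  have p: "tendsto_in_prob M (\<lambda>n \<omega>. ?f (Y n \<omega> - Z n \<omega>)) 0"
    by simp
  have b: "?f x \<le> 2" for x
    using norm_triangle_ineq4[of "iexp (t * x)" 1] by simp
  have lim: "(\<lambda>n. expectation (\<lambda>\<omega>. \<bar>?f (Y n \<omega> - Z n \<omega>)\<bar>)) \<longlonglongrightarrow> 0"
    by (rule tendsto_in_prob_imp_expectation[OF _ p, where B=2]) (measurable, simp only: abs_norm_cancel b simp_thms)
  have int: "complex_integrable M (\<lambda>\<omega>. iexp (t * X \<omega>))" if [measurable]: "X \<in> borel_measurable M" for X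
    by (rule integrable_const_bound[where B=1]) auto
  show ?thesis
  proof (rule Lim_null_comparison[OF always_eventually[OF allI] lim])
    fix n
    have "cmod ((CLINT \<omega>|M. iexp (t * Y n \<omega>)) - (CLINT \<omega>|M. iexp (t * Z n \<omega>)))
        = cmod (CLINT \<omega>|M. iexp (t * Y n \<omega>) - iexp (t * Z n \<omega>))"
      by (subst Bochner_Integration.integral_diff[OF int int]) auto
    also have "\<dots> \<le> expectation (\<lambda>\<omega>. cmod (iexp (t * Y n \<omega>) - iexp (t * Z n \<omega>)))"
      by (rule integral_norm_bound)
    also have "\<dots> = expectation (\<lambda>\<omega>. \<bar>?f (Y n \<omega> - Z n \<omega>)\<bar>)"
    proof (intro Bochner_Integration.integral_cong refl)
      fix \<omega>
      have "iexp (t * Y n \<omega>) - iexp (t * Z n \<omega>)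
          = iexp (t * Z n \<omega>) * (iexp (t * (Y n \<omega> - Z n \<omega>)) - 1)"
        by (simp add: algebra_simps exp_add[symmetric])
      then show "cmod (iexp (t * Y n \<omega>) - iexp (t * Z n \<omega>)) = \<bar>?f (Y n \<omega> - Z n \<omega>)\<bar>"
        by (simp add: norm_mult)
    qed
    finally show "cmod ((CLINT \<omega>|M. iexp (t * Y n \<omega>)) - (CLINT \<omega>|M. iexp (t * Z n \<omega>)))
        \<le> expectation (\<lambda>\<omega>. \<bar>?f (Y n \<omega> - Z n \<omega>)\<bar>)" .
  qed
qed

end

text \<open>For positive \<open>v\<close> the law is the image of the standard normal law under
  multiplication by \<open>sqrt v\<close>. The point mass at \<open>v = 0\<close> has constant
  characteristic function 1, in agreement with the same formula.\<close>

lemma char_centred_normal: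
  assumes "0 \<le> v"
  shows "real_distribution (centred_normal v)"
    and "char (centred_normal v) t = exp (- (t\<^sup>2) * v / 2)"
proof -
  have "real_distribution (centred_normal v) \<and> char (centred_normal v) t = exp (- (t\<^sup>2) * v / 2)"
  proof (cases "v = 0")
    case True
    then show ?thesis
      by (auto simp: centred_normal_def char_def integral_return real_distribution_def
          real_distribution_axioms_def prob_space_return)
  next
    case False
    with assms have v: "0 < sqrt v" by simp
    interpret N: prob_space std_normal_distribution
      by (rule prob_space_normal_density) simp
    have "distributed std_normal_distribution lborel (\<lambda>x. x) (\<lambda>x. ennreal (std_normal_density x))"
      by (auto simp: distributed_def distr_id2 sets_borel)
    from N.normal_density_affine[OF this, of "sqrt v" 0] v
    have eq: "centred_normal v = distr std_normal_distribution borel (\<lambda>x. sqrt v * x)"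
      using False by (auto simp: distributed_def centred_normal_def cong: distr_cong)
    have "char (centred_normal v) t = char std_normal_distribution (t * sqrt v)"
      unfolding eq char_def by (subst integral_distr) (auto simp: mult.assoc)
    then have "char (centred_normal v) t = exp (- (t\<^sup>2) * v / 2)"
      using assms by (simp add: char_std_normal_distribution power_mult_distrib)
    moreover have "real_distribution (centred_normal v)"
      unfolding eq by (rule N.real_distribution_distr) simp
    ultimately show ?thesis by blast
  qed
  then show "real_distribution (centred_normal v)"
    and "char (centred_normal v) t = exp (- (t\<^sup>2) * v / 2)" by auto
qed

section \<open>Bounded martingale differences\<close>

text \<open>Follows from \<open>exp (- a) \<le> 1 / (1 + a) \<le> 1 - a + a^2\<close> and the
  tangent-line lower bound. It measures the cost of replacing the exponential compensator of one
  step by its linear part.\<close>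

lemma abs_exp_minus_linear_le:
  fixes a :: real
  assumes "0 \<le> a"
  shows "\<bar>1 - a - exp (- a)\<bar> \<le> a\<^sup>2"
proof -
  have "1 - a \<le> exp (- a)"
    using exp_ge_add_one_self[of "- a"] by simp
  moreover have "exp (- a) \<le> 1 / (1 + a)"
    using exp_ge_add_one_self[of a] assms by (simp add: exp_minus field_simps)
  moreover have "1 / (1 + a) \<le> 1 - a + a\<^sup>2"
  proof -
    have "(1 - a + a\<^sup>2) * (1 + a) = 1 + a ^ 3"
      by (simp add: algebra_simps power2_eq_square power3_eq_cube)
    then have "1 \<le> (1 - a + a\<^sup>2) * (1 + a)"
      using assms by simp
    then show ?thesis
      using assms by (simp add: divide_le_eq)
  qed
  ultimately show ?thesis
    by linarith
qed

lemma cmod_iexp_quadratic_le: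
  "cmod (iexp y - (1 + \<i> * y - y\<^sup>2 / 2)) \<le> \<bar>y\<bar> ^ 3 / 6"
proof -
  have "(\<Sum>k\<le>2. (\<i> * complex_of_real y) ^ k / fact k) = 1 + \<i> * y - y\<^sup>2 / 2"
    by (simp add: numeral_2_eq_2 power_mult_distrib)
  then show ?thesis
    using iexp_approx1[of y 2] by (simp add: fact_numeral)
qed

text \<open>The condition \<open>\<xi>_centred\<close> is \<open>E(\<xi> k | F k) = 0\<close> in
  tested form. Orthogonality of increments and the exponential estimate both multiply an increment
  by a bounded function of the past, so this form applies directly. The increment with index
  \<open>k\<close> becomes known at time \<open>k + 1\<close>.\<close>

locale bounded_martingale_differences = prob_space M
  for M :: "'w measure" +
  fixes F :: "nat \<Rightarrow> 'w measure" and \<xi> :: "nat \<Rightarrow> 'w \<Rightarrow> real" and c :: real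
  assumes subalg: "\<And>k. subalgebra M (F k)"
    and F_mono: "\<And>i j. i \<le> j \<Longrightarrow> subalgebra (F j) (F i)"
    and \<xi>_adapted: "\<And>k. \<xi> k \<in> borel_measurable (F (Suc k))"
    and \<xi>_bound: "\<And>k \<omega>. \<omega> \<in> space M \<Longrightarrow> \<bar>\<xi> k \<omega>\<bar> \<le> c"
    and \<xi>_centred: "\<And>k W b. W \<in> borel_measurable (F k) \<Longrightarrow>
      (\<And>\<omega>. \<omega> \<in> space M \<Longrightarrow> \<bar>W \<omega>\<bar> \<le> b) \<Longrightarrow> expectation (\<lambda>\<omega>. W \<omega> * \<xi> k \<omega>) = 0"
begin

definition S :: "nat \<Rightarrow> 'w \<Rightarrow> real" where
  "S n \<omega> = (\<Sum>k<n. \<xi> k \<omega>)"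

lemma S_adapted: "S n \<in> borel_measurable (F n)"
  unfolding S_def
proof (rule borel_measurable_sum)
  fix k assume "k \<in> {..<n}"
  then show "\<xi> k \<in> borel_measurable (F n)"
    by (intro measurable_from_subalg[OF F_mono \<xi>_adapted]) auto
qed

lemma S_measurable[measurable]: "S n \<in> borel_measurable M"
  by (rule measurable_from_subalg[OF subalg S_adapted])

lemma \<xi>_measurable[measurable]: "\<xi> n \<in> borel_measurable M"
  by (rule measurable_from_subalg[OF subalg \<xi>_adapted])

lemma S_bound: "\<omega> \<in> space M \<Longrightarrow> \<bar>S n \<omega>\<bar> \<le> real n * c"
  unfolding S_def using sum_bounded_above[of "{..<n}" "\<lambda>k. \<bar>\<xi> k \<omega>\<bar>" c] \<xi>_bound[of \<omega>]
  by (intro order_trans[OF sum_abs]) auto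

lemma c_nonneg: "0 \<le> c"
  using \<xi>_bound not_empty by force

lemma S_square_bound: "\<omega> \<in> space M \<Longrightarrow> (S n \<omega>)\<^sup>2 \<le> (real n * c)\<^sup>2"
  using S_bound[of \<omega> n] c_nonneg by (simp add: abs_le_square_iff[symmetric] abs_mult)

lemma integrable_S_square: "integrable M (\<lambda>\<omega>. (S n \<omega>)\<^sup>2)"
  by (rule integrable_of_bounded[where B="(real n * c)\<^sup>2"]) (simp_all add: S_square_bound)

text \<open>The cross term vanishes because \<open>S n\<close> is itself a bounded
  \<open>F n\<close>-measurable weight; each step then adds at most \<open>c^2\<close>.\<close>

lemma second_moment_S: "expectation (\<lambda>\<omega>. (S n \<omega>)\<^sup>2) \<le> real n * c\<^sup>2"
proof (induction n)
  case 0
  show ?case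
    by (simp add: S_def)
next
  case (Suc n)
  have \<xi>2: "\<omega> \<in> space M \<Longrightarrow> (\<xi> n \<omega>)\<^sup>2 \<le> c\<^sup>2" for \<omega>
    using \<xi>_bound[of \<omega> n] c_nonneg by (simp add: abs_le_square_iff[symmetric])
  have int\<xi>2: "integrable M (\<lambda>\<omega>. (\<xi> n \<omega>)\<^sup>2)"
    by (rule integrable_of_bounded[where B="c\<^sup>2"]) (simp_all add: \<xi>2)
  have intS\<xi>: "integrable M (\<lambda>\<omega>. S n \<omega> * \<xi> n \<omega>)"
  proof (rule integrable_of_bounded)
    show "\<bar>S n \<omega> * \<xi> n \<omega>\<bar> \<le> (real n * c) * c" if "\<omega> \<in> space M" for \<omega>
      unfolding abs_mult using S_bound[OF that] \<xi>_bound[OF that] c_nonneg by (intro mult_mono) auto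
  qed measurable
  have "(\<lambda>\<omega>. (S (Suc n) \<omega>)\<^sup>2) = (\<lambda>\<omega>. (S n \<omega>)\<^sup>2 + (2 * (S n \<omega> * \<xi> n \<omega>) + (\<xi> n \<omega>)\<^sup>2))"
    by (simp add: S_def power2_eq_square algebra_simps)
  then have "expectation (\<lambda>\<omega>. (S (Suc n) \<omega>)\<^sup>2)
      = expectation (\<lambda>\<omega>. (S n \<omega>)\<^sup>2) + (2 * expectation (\<lambda>\<omega>. S n \<omega> * \<xi> n \<omega>)
          + expectation (\<lambda>\<omega>. (\<xi> n \<omega>)\<^sup>2))"
    using integrable_S_square intS\<xi> int\<xi>2 by simp
  also have "expectation (\<lambda>\<omega>. S n \<omega> * \<xi> n \<omega>) = 0"
    by (rule \<xi>_centred[OF S_adapted S_bound])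
  also have "expectation (\<lambda>\<omega>. (\<xi> n \<omega>)\<^sup>2) \<le> c\<^sup>2"
    using integral_le_const[OF int\<xi>2] \<xi>2 by auto
  finally show ?case
    using Suc.IH by (simp add: algebra_simps)
qed

lemma weak_law: "tendsto_in_prob M (\<lambda>n \<omega>. S n \<omega> / real n) 0"
proof (rule second_moment_imp_tendsto_in_prob)
  show "integrable M (\<lambda>\<omega>. (S n \<omega> / real n)\<^sup>2)" for n
    unfolding power_divide by (rule integrable_divide) (rule integrable_S_square)
  show "(\<lambda>n. expectation (\<lambda>\<omega>. (S n \<omega> / real n)\<^sup>2)) \<longlonglongrightarrow> 0"
  proof (rule tendsto_sandwich[OF _ _ tendsto_const])
    show "(\<lambda>n. c\<^sup>2 / real n) \<longlonglongrightarrow> 0"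
      by real_asymp
    show "\<forall>\<^sub>F n in sequentially. expectation (\<lambda>\<omega>. (S n \<omega> / real n)\<^sup>2) \<le> c\<^sup>2 / real n"
      using eventually_gt_at_top[of 0]
    proof eventually_elim
      case (elim n)
      have "expectation (\<lambda>\<omega>. (S n \<omega> / real n)\<^sup>2) = expectation (\<lambda>\<omega>. (S n \<omega>)\<^sup>2) / (real n)\<^sup>2"
        unfolding power_divide by simp
      also have "\<dots> \<le> real n * c\<^sup>2 / (real n)\<^sup>2"
        by (intro divide_right_mono second_moment_S) simp
      also have "\<dots> = c\<^sup>2 / real n"
        using elim by (simp add: power2_eq_square)
      finally show ?case .
    qed
    show "\<forall>\<^sub>F n in sequentially. 0 \<le> expectation (\<lambda>\<omega>. (S n \<omega> / real n)\<^sup>2)"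
      by (rule always_eventually) (auto intro: Bochner_Integration.integral_nonneg)
  qed
qed measurable

lemma S_increment_bound:
  assumes \<omega>: "\<omega> \<in> space M" and mn: "m \<le> n"
  shows "\<bar>S n \<omega> - S m \<omega>\<bar> \<le> real (n - m) * c"
proof -
  have "S n \<omega> - S m \<omega> = (\<Sum>k\<in>{m..<n}. \<xi> k \<omega>)"
    unfolding S_def lessThan_atLeast0 by (rule sum_diff_nat_ivl[OF _ mn]) simp
  also have "\<bar>\<dots>\<bar> \<le> (\<Sum>k\<in>{m..<n}. c)"
    by (rule order_trans[OF sum_abs sum_mono]) (rule \<xi>_bound[OF \<omega>])
  finally show ?thesis
    by simp
qed

text \<open>Along squares the second moments of the averages are at most \<open>c^2 / m^2\<close>,
  which is summable. Hence the sum of the squared averages has finite expectation, is almost surely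
  finite, and its terms tend to zero.\<close>

lemma strong_law_squares: "AE \<omega> in M. (\<lambda>m. S (m\<^sup>2) \<omega> / real (m\<^sup>2)) \<longlonglongrightarrow> 0"
proof -
  define T where "T m \<omega> = (S (m\<^sup>2) \<omega> / real (m\<^sup>2))\<^sup>2" for m \<omega>
  have T[measurable]: "T m \<in> borel_measurable M" for m
    unfolding T_def by measurable
  have intT: "integrable M (T m)" for m
    unfolding T_def power_divide by (intro integrable_divide integrable_S_square)
  have ET: "expectation (T m) \<le> c\<^sup>2 * inverse (real m ^ 2)" for m
  proof (cases "m = 0")
    case False
    have "expectation (T m) = expectation (\<lambda>\<omega>. (S (m\<^sup>2) \<omega>)\<^sup>2) / (real (m\<^sup>2))\<^sup>2"
      unfolding T_def power_divide by simp
    also have "\<dots> \<le> real (m\<^sup>2) * c\<^sup>2 / (real (m\<^sup>2))\<^sup>2"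
      by (intro divide_right_mono second_moment_S) simp
    also have "\<dots> = c\<^sup>2 * inverse (real m ^ 2)"
      using False by (simp add: power2_eq_square field_simps)
    finally show ?thesis .
  next
    \<comment> \<open>At \<open>m = 0\<close> both sides are zero by the conventions for division
      and inverse.\<close>
    case True
    have "T 0 = (\<lambda>_. 0)"
      by (simp add: T_def fun_eq_iff)
    then show ?thesis
      by (simp add: True)
  qed
  have sum: "summable (\<lambda>m. c\<^sup>2 * inverse (real m ^ 2))"
    by (intro summable_mult inverse_power_summable) simp
  have "(\<integral>\<^sup>+\<omega>. (\<Sum>m. ennreal (T m \<omega>)) \<partial>M) = (\<Sum>m. \<integral>\<^sup>+\<omega>. ennreal (T m \<omega>) \<partial>M)"
    by (rule nn_integral_suminf) measurable
  also have "\<dots> = (\<Sum>m. ennreal (expectation (T m)))"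
    by (intro suminf_cong nn_integral_eq_integral intT AE_I2) (simp add: T_def)
  also have "\<dots> \<le> (\<Sum>m. ennreal (c\<^sup>2 * inverse (real m ^ 2)))"
    by (rule suminf_le[OF ennreal_leI[OF ET] summableI summableI])
  also have "\<dots> < \<infinity>"
    unfolding infinity_ennreal_def less_top[symmetric]
    by (rule ennreal_suminf_neq_top[OF sum]) simp
  finally have "AE \<omega> in M. (\<Sum>m. ennreal (T m \<omega>)) \<noteq> \<infinity>"
    by (intro nn_integral_PInf_AE) simp_all
  then show ?thesis
  proof eventually_elim
    case (elim \<omega>)
    then have "summable (\<lambda>m. T m \<omega>)"
      by (intro summable_suminf_not_top) (auto simp: T_def)
    then have "(\<lambda>m. T m \<omega>) \<longlonglongrightarrow> 0"
      by (rule summable_LIMSEQ_zero)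
    then have "(\<lambda>m. sqrt (T m \<omega>)) \<longlonglongrightarrow> sqrt 0"
      by (rule tendsto_real_sqrt)
    then have "(\<lambda>m. \<bar>S (m\<^sup>2) \<omega> / real (m\<^sup>2)\<bar>) \<longlonglongrightarrow> 0"
      by (simp only: T_def real_sqrt_abs real_sqrt_zero)
    then show ?case
      by (rule tendsto_rabs_zero_cancel)
  qed
qed

text \<open>With \<open>r n\<close> the integer square root, \<open>n\<close> exceeds
  \<open>(r n)^2\<close> by at most \<open>2 * r n\<close>. Bounded increments then change the sum
  by \<open>O(r n)\<close>, which is negligible against \<open>(r n)^2\<close>.\<close>

lemma strong_law: "AE \<omega> in M. (\<lambda>n. S n \<omega> / real n) \<longlonglongrightarrow> 0"
  using strong_law_squares AE_space
proof eventually_elim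
  case (elim \<omega>)
  define r where "r n = floor_sqrt n" for n
  have r: "(r n)\<^sup>2 \<le> n" "n < (Suc (r n))\<^sup>2" for n
    unfolding r_def by (simp_all add: floor_sqrt_power2_le Suc_floor_sqrt_power2_gt)
  have r_lim: "filterlim r at_top sequentially"
    unfolding filterlim_at_top
  proof
    fix Z :: nat
    show "\<forall>\<^sub>F n in sequentially. Z \<le> r n"
      using eventually_ge_at_top[of "Z\<^sup>2"]
    proof eventually_elim
      case (elim n)
      then have "Z\<^sup>2 < (Suc (r n))\<^sup>2"
        using r(2)[of n] by linarith
      then show "Z \<le> r n"
        by (simp add: power2_less_imp_less less_Suc_eq_le[symmetric])
    qed
  qed
  let ?u = "\<lambda>m. \<bar>S (m\<^sup>2) \<omega> / real (m\<^sup>2)\<bar> + 3 * c / real m"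
  have "(\<lambda>m. 3 * c / real m) \<longlonglongrightarrow> 0"
    by real_asymp
  then have "?u \<longlonglongrightarrow> 0 + 0"
    using elim(1) by (intro tendsto_add tendsto_rabs_zero)
  then have lim: "(\<lambda>n. ?u (r n)) \<longlonglongrightarrow> 0"
    using filterlim_compose[OF _ r_lim] by simp
  show "(\<lambda>n. S n \<omega> / real n) \<longlonglongrightarrow> 0"
  proof (rule Lim_null_comparison[OF _ lim])
    have "\<forall>\<^sub>F n in sequentially. 1 \<le> r n"
      using r_lim unfolding filterlim_at_top by blast
    then show "\<forall>\<^sub>F n in sequentially. norm (S n \<omega> / real n) \<le> ?u (r n)"
    proof eventually_elim
      case (elim n)
      let ?m = "r n"
      have m: "1 \<le> real ?m" "real (?m\<^sup>2) \<le> real n" "0 < real (?m\<^sup>2)"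
        using elim of_nat_mono[OF r(1)[of n], where ?'a = real] by simp_all
      \<comment> \<open>From \<open>n < (m + 1)^2 = m^2 + 2 * m + 1\<close>; the factor 3 in
        \<open>?u\<close> leaves some slack over this 2.\<close>
      have "n - ?m\<^sup>2 \<le> 2 * ?m"
        using r(2)[of n] by (simp add: power2_eq_square)
      then have "real (n - ?m\<^sup>2) \<le> real (2 * ?m)"
        by (rule of_nat_mono)
      then have d: "real (n - ?m\<^sup>2) \<le> 3 * real ?m"
        by simp
      have "\<bar>S n \<omega>\<bar> \<le> \<bar>S (?m\<^sup>2) \<omega>\<bar> + real (n - ?m\<^sup>2) * c"
        using S_increment_bound[OF \<open>\<omega> \<in> space M\<close> r(1)[of n]] by linarith
      also have "\<dots> \<le> \<bar>S (?m\<^sup>2) \<omega>\<bar> + 3 * real ?m * c"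
        using d c_nonneg by (intro add_left_mono mult_right_mono)
      finally have "\<bar>S n \<omega>\<bar> / real n \<le> (\<bar>S (?m\<^sup>2) \<omega>\<bar> + 3 * real ?m * c) / real (?m\<^sup>2)"
        using m c_nonneg by (intro frac_le) auto
      also have "\<dots> = ?u ?m"
        using m by (simp add: add_divide_distrib power2_eq_square)
      finally show ?case
        by simp
    qed
  qed
qed

end


section \<open>Central limit theorem for bounded martingale differences\<close>

lemma (in prob_space) complex_expectation_mult_zero:
  assumes sub: "subalgebra M G" and Y[measurable]: "Y \<in> borel_measurable M"
    and Y_bound: "\<And>\<omega>. \<omega> \<in> space M \<Longrightarrow> \<bar>Y \<omega>\<bar> \<le> d"
    and real: "\<And>W b. W \<in> borel_measurable G \<Longrightarrow> (\<And>\<omega>. \<omega> \<in> space M \<Longrightarrow> \<bar>W \<omega>\<bar> \<le> b) \<Longrightarrow>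
      expectation (\<lambda>\<omega>. W \<omega> * Y \<omega>) = 0"
    and W: "W \<in> borel_measurable G" "\<And>\<omega>. \<omega> \<in> space M \<Longrightarrow> cmod (W \<omega>) \<le> b"
  shows "(CLINT \<omega>|M. W \<omega> * complex_of_real (Y \<omega>)) = 0"
proof -
  have [measurable]: "W \<in> borel_measurable M"
    by (rule measurable_from_subalg[OF sub W(1)])
  have int: "complex_integrable M (\<lambda>\<omega>. W \<omega> * complex_of_real (Y \<omega>))"
  proof (rule integrable_const_bound[where B="b * d"])
    show "AE \<omega> in M. cmod (W \<omega> * complex_of_real (Y \<omega>)) \<le> b * d"
    proof (intro AE_I2)
      fix \<omega> assume "\<omega> \<in> space M"
      from W(2)[OF this] Y_bound[OF this] show "cmod (W \<omega> * complex_of_real (Y \<omega>)) \<le> b * d"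
        unfolding norm_mult norm_of_real
        by (intro mult_mono) (auto intro: order_trans[OF norm_ge_zero])
    qed
  qed measurable
  show ?thesis
  \<comment> \<open>The centring hypothesis speaks of real weights. The real and imaginary parts of
    \<open>W\<close> are such weights, each bounded by the modulus.\<close>
  proof (rule complex_eqI)
    have "expectation (\<lambda>\<omega>. Re (W \<omega>) * Y \<omega>) = 0"
      by (rule real) (use W in \<open>auto intro: order_trans[OF abs_Re_le_cmod]\<close>)
    then show "Re (CLINT \<omega>|M. W \<omega> * complex_of_real (Y \<omega>)) = Re 0"
      unfolding integral_Re[OF int, symmetric] by simp
    have "expectation (\<lambda>\<omega>. Im (W \<omega>) * Y \<omega>) = 0"
      by (rule real) (use W in \<open>auto intro: order_trans[OF abs_Im_le_cmod]\<close>)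
    then show "Im (CLINT \<omega>|M. W \<omega> * complex_of_real (Y \<omega>)) = Im 0"
      unfolding integral_Im[OF int, symmetric] by simp
  qed
qed

text \<open>\<open>V k\<close> is the conditional variance of \<open>\<xi> k\<close> given
  \<open>F k\<close>, again in tested form. It is known already at time \<open>k\<close>, one step
  before \<open>\<xi> k\<close>; the compensating factor of a step can therefore be absorbed into a
  weight.\<close>

locale bounded_martingale_differences_variance = bounded_martingale_differences +
  fixes V :: "nat \<Rightarrow> 'a \<Rightarrow> real" and b :: real
  assumes V_adapted: "\<And>k. V k \<in> borel_measurable (F k)"
    and V_bound: "\<And>k \<omega>. \<omega> \<in> space M \<Longrightarrow> 0 \<le> V k \<omega> \<and> V k \<omega> \<le> b"
    and V_cond_variance: "\<And>k W d. W \<in> borel_measurable (F k) \<Longrightarrow>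
      (\<And>\<omega>. \<omega> \<in> space M \<Longrightarrow> \<bar>W \<omega>\<bar> \<le> d) \<Longrightarrow>
      expectation (\<lambda>\<omega>. W \<omega> * ((\<xi> k \<omega>)\<^sup>2 - V k \<omega>)) = 0"
begin

lemma V_measurable[measurable]: "V k \<in> borel_measurable M"
  by (rule measurable_from_subalg[OF subalg V_adapted])

definition Q :: "nat \<Rightarrow> 'a \<Rightarrow> real" where
  "Q n \<omega> = (\<Sum>k<n. V k \<omega>)"

lemma Q_adapted: "Q n \<in> borel_measurable (F n)"
  unfolding Q_def
proof (rule borel_measurable_sum)
  fix k assume "k \<in> {..<n}"
  then show "V k \<in> borel_measurable (F n)"
    by (intro measurable_from_subalg[OF F_mono V_adapted]) auto
qed

lemma Q_measurable[measurable]: "Q n \<in> borel_measurable M"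
  by (rule measurable_from_subalg[OF subalg Q_adapted])

lemma b_nonneg: "0 \<le> b"
  using V_bound not_empty by force

lemma Q_bound: "\<omega> \<in> space M \<Longrightarrow> 0 \<le> Q n \<omega> \<and> Q n \<omega> \<le> real n * b"
  unfolding Q_def using sum_bounded_above[of "{..<n}" "\<lambda>k. V k \<omega>" b] V_bound[of \<omega>]
  by (auto intro: sum_nonneg)

text \<open>
  The compensated exponential is almost a martingale. Since its modulus depends only on the
  bounded quadratic characteristic \<^term>\<open>Q\<close>, no stopping is needed.
\<close>

definition Z :: "real \<Rightarrow> nat \<Rightarrow> 'a \<Rightarrow> complex" where
  "Z u k \<omega> = complex_of_real (exp (u\<^sup>2 * Q k \<omega> / 2)) * iexp (u * S k \<omega>)"

lemma Z_adapted: "Z u k \<in> borel_measurable (F k)"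
proof -
  note [measurable] = Q_adapted[of k] S_adapted[of k]
  show ?thesis
    unfolding Z_def[abs_def] by measurable
qed

lemma Z_measurable[measurable]: "Z u k \<in> borel_measurable M"
  by (rule measurable_from_subalg[OF subalg Z_adapted])

lemma cmod_Z: "cmod (Z u k \<omega>) = exp (u\<^sup>2 * Q k \<omega> / 2)"
  by (simp add: Z_def norm_mult)

lemma cmod_Z_le: "\<omega> \<in> space M \<Longrightarrow> cmod (Z u k \<omega>) \<le> exp (u\<^sup>2 * (real k * b) / 2)"
  unfolding cmod_Z using Q_bound[of \<omega> k] by (simp add: mult_left_mono)

lemma integrable_Z: "complex_integrable M (Z u k)"
  by (rule integrable_const_bound[where B="exp (u\<^sup>2 * (real k * b) / 2)"])
     (auto intro!: AE_I2 cmod_Z_le)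

text \<open>The increment equals \<open>W * (iexp (u * \<xi> k) - exp (- a))\<close> with
  \<open>a = u^2 * V k / 2\<close>. Expanding to second order in \<open>\<xi> k\<close> and first
  order in \<open>a\<close>, the constants cancel and there remain multiples of
  \<open>\<xi> k\<close> and of \<open>(\<xi> k)^2 - V k\<close>, both orthogonal to
  \<open>W\<close>. Only the cubic Taylor error and the error of order \<open>a^2\<close> survive.
  Having \<open>n\<close> and not \<open>k\<close> in the exponent makes the bound the same for all
  steps up to \<open>n\<close>.\<close>

lemma Z_step:
  assumes kn: "Suc k \<le> n"
  shows "cmod ((CLINT \<omega>|M. Z u (Suc k) \<omega>) - (CLINT \<omega>|M. Z u k \<omega>))
    \<le> exp (u\<^sup>2 * (real n * b) / 2) * ((\<bar>u\<bar> * c) ^ 3 / 6 + (u\<^sup>2 * b / 2)\<^sup>2)"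
proof -
  define G where "G = exp (u\<^sup>2 * (real n * b) / 2)"
  define a where "a \<omega> = u\<^sup>2 * V k \<omega> / 2" for \<omega>
  \<comment> \<open>\<open>W\<close> carries the compensator of time \<open>k + 1\<close> but the
    oscillating factor of time \<open>k\<close>. Because \<open>V k\<close> is
    \<open>F k\<close>-measurable, so is \<open>W\<close>, as the orthogonality relations
    require.\<close>
  define W where "W \<omega> = Z u k \<omega> * complex_of_real (exp (a \<omega>))" for \<omega>
  note [measurable] = Z_adapted[of u k] V_adapted[of k]
  have W_adapted: "W \<in> borel_measurable (F k)"
    unfolding W_def[abs_def] a_def[abs_def] by measurable
  have [measurable]: "W \<in> borel_measurable M" "a \<in> borel_measurable M"
    unfolding a_def[abs_def] by (rule measurable_from_subalg[OF subalg W_adapted]) measurable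
  have W_bound: "cmod (W \<omega>) \<le> G" if \<omega>: "\<omega> \<in> space M" for \<omega>
  proof -
    have "cmod (W \<omega>) = exp (u\<^sup>2 * Q (Suc k) \<omega> / 2)"
      by (simp add: W_def norm_mult cmod_Z a_def Q_def exp_add[symmetric] algebra_simps add_divide_distrib)
    also have "\<dots> \<le> G"
    proof -
      have "Q (Suc k) \<omega> \<le> real n * b"
        using Q_bound[OF \<omega>, of "Suc k"] mult_right_mono[OF of_nat_mono[OF kn] b_nonneg] by (simp del: of_nat_Suc)
      then show ?thesis
        unfolding G_def by (simp add: mult_left_mono)
    qed
    finally show ?thesis .
  qed
  have a: "0 \<le> a \<omega>" "a \<omega> \<le> u\<^sup>2 * b / 2" if "\<omega> \<in> space M" for \<omega>
    unfolding a_def using V_bound[OF that, of k] by (auto simp: mult_left_mono)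
  have \<xi>2: "\<omega> \<in> space M \<Longrightarrow> (\<xi> k \<omega>)\<^sup>2 \<le> c\<^sup>2" for \<omega>
    using \<xi>_bound[of \<omega> k] c_nonneg by (simp add: abs_le_square_iff[symmetric])
  have E1: "(CLINT \<omega>|M. W \<omega> * complex_of_real (\<xi> k \<omega>)) = 0"
    by (rule complex_expectation_mult_zero[OF subalg _ \<xi>_bound \<xi>_centred W_adapted W_bound]) simp_all
  have E2: "(CLINT \<omega>|M. W \<omega> * complex_of_real ((\<xi> k \<omega>)\<^sup>2 - V k \<omega>)) = 0"
  proof (rule complex_expectation_mult_zero[OF subalg _ _ V_cond_variance W_adapted W_bound])
    show "\<bar>(\<xi> k \<omega>)\<^sup>2 - V k \<omega>\<bar> \<le> c\<^sup>2 + b" if "\<omega> \<in> space M" for \<omega>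
      using \<xi>2[OF that] V_bound[OF that, of k] zero_le_power2[of "\<xi> k \<omega>"] by linarith
  qed simp_all
  have int1: "complex_integrable M (\<lambda>\<omega>. W \<omega> * complex_of_real (\<xi> k \<omega>))"
  proof (rule integrable_const_bound[where B="G * c"])
    show "AE \<omega> in M. cmod (W \<omega> * complex_of_real (\<xi> k \<omega>)) \<le> G * c"
      unfolding norm_mult norm_of_real
      by (intro AE_I2 mult_mono W_bound \<xi>_bound) (simp_all add: G_def)
  qed measurable
  have int2: "complex_integrable M (\<lambda>\<omega>. W \<omega> * complex_of_real ((\<xi> k \<omega>)\<^sup>2 - V k \<omega>))"
  proof (rule integrable_const_bound[where B="G * (c\<^sup>2 + b)"])
    show "AE \<omega> in M. cmod (W \<omega> * complex_of_real ((\<xi> k \<omega>)\<^sup>2 - V k \<omega>)) \<le> G * (c\<^sup>2 + b)"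
    proof (intro AE_I2)
      fix \<omega> assume \<omega>: "\<omega> \<in> space M"
      have "\<bar>(\<xi> k \<omega>)\<^sup>2 - V k \<omega>\<bar> \<le> c\<^sup>2 + b"
        using \<xi>2[OF \<omega>] V_bound[OF \<omega>, of k] zero_le_power2[of "\<xi> k \<omega>"] by linarith
      then show "cmod (W \<omega> * complex_of_real ((\<xi> k \<omega>)\<^sup>2 - V k \<omega>)) \<le> G * (c\<^sup>2 + b)"
        unfolding norm_mult norm_of_real using W_bound[OF \<omega>] by (intro mult_mono) (auto simp: G_def)
    qed
  qed measurable
  \<comment> \<open>\<open>R\<close> is the increment with its two mean-zero terms removed, so it
    has the same expectation as the increment while being pointwise small.\<close>
  define R where "R \<omega> = Z u (Suc k) \<omega> - Z u k \<omega>
    - \<i> * u * (W \<omega> * complex_of_real (\<xi> k \<omega>))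
    + u\<^sup>2 / 2 * (W \<omega> * complex_of_real ((\<xi> k \<omega>)\<^sup>2 - V k \<omega>))" for \<omega>
  have R_eq: "R \<omega> = W \<omega> * ((iexp (u * \<xi> k \<omega>) - (1 + \<i> * (u * \<xi> k \<omega>) - (u * \<xi> k \<omega>)\<^sup>2 / 2))
      + complex_of_real (1 - a \<omega> - exp (- a \<omega>)))" for \<omega>
  proof -
    have "exp (u\<^sup>2 * Q (Suc k) \<omega> / 2) = exp (u\<^sup>2 * Q k \<omega> / 2) * exp (a \<omega>)"
      by (simp add: Q_def a_def exp_add[symmetric] algebra_simps add_divide_distrib)
    moreover have "iexp (u * S (Suc k) \<omega>) = iexp (u * S k \<omega>) * iexp (u * \<xi> k \<omega>)"
      by (simp add: S_def exp_add[symmetric] algebra_simps)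
    ultimately have Z1: "Z u (Suc k) \<omega> = W \<omega> * iexp (u * \<xi> k \<omega>)"
      by (simp only: Z_def W_def of_real_mult mult_ac)
    have "W \<omega> * complex_of_real (exp (- a \<omega>)) = Z u k \<omega> * complex_of_real (exp (a \<omega>) * exp (- a \<omega>))"
      unfolding W_def by (simp only: of_real_mult mult.assoc)
    then have Z0: "Z u k \<omega> = W \<omega> * complex_of_real (exp (- a \<omega>))"
      by (simp only: exp_add[symmetric]) simp
    show ?thesis
      unfolding R_def Z1 by (subst Z0) (simp add: a_def algebra_simps power_mult_distrib)
  qed
  have R_bound: "cmod (R \<omega>) \<le> G * ((\<bar>u\<bar> * c) ^ 3 / 6 + (u\<^sup>2 * b / 2)\<^sup>2)" if \<omega>: "\<omega> \<in> space M" for \<omega>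
    unfolding R_eq norm_mult
  proof (intro mult_mono W_bound \<omega> order_trans[OF norm_triangle_ineq] add_mono)
    have "cmod (iexp (u * \<xi> k \<omega>) - (1 + \<i> * (u * \<xi> k \<omega>) - (u * \<xi> k \<omega>)\<^sup>2 / 2))
        \<le> \<bar>u * \<xi> k \<omega>\<bar> ^ 3 / 6"
      using cmod_iexp_quadratic_le[of "u * \<xi> k \<omega>"] by simp
    also have "\<dots> \<le> (\<bar>u\<bar> * c) ^ 3 / 6"
      unfolding abs_mult using \<xi>_bound[OF \<omega>, of k] by (intro divide_right_mono power_mono mult_left_mono) auto
    finally show "cmod (iexp (u * \<xi> k \<omega>) - (1 + \<i> * (u * \<xi> k \<omega>) - (u * \<xi> k \<omega>)\<^sup>2 / 2))
        \<le> (\<bar>u\<bar> * c) ^ 3 / 6" .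
    have "cmod (complex_of_real (1 - a \<omega> - exp (- a \<omega>))) = \<bar>1 - a \<omega> - exp (- a \<omega>)\<bar>"
      by (rule norm_of_real)
    also have "\<dots> \<le> (a \<omega>)\<^sup>2"
      by (rule abs_exp_minus_linear_le[OF a(1)[OF \<omega>]])
    also have "\<dots> \<le> (u\<^sup>2 * b / 2)\<^sup>2"
      by (rule power_mono[OF a(2,1)[OF \<omega>]])
    finally show "cmod (complex_of_real (1 - a \<omega> - exp (- a \<omega>))) \<le> (u\<^sup>2 * b / 2)\<^sup>2" .
  qed (auto simp: G_def)
  have "(CLINT \<omega>|M. R \<omega>) = (CLINT \<omega>|M. Z u (Suc k) \<omega>) - (CLINT \<omega>|M. Z u k \<omega>)
      - \<i> * u * (CLINT \<omega>|M. W \<omega> * complex_of_real (\<xi> k \<omega>))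
      + u\<^sup>2 / 2 * (CLINT \<omega>|M. W \<omega> * complex_of_real ((\<xi> k \<omega>)\<^sup>2 - V k \<omega>))"
    unfolding R_def[abs_def]
    by (simp add: int1 int2 integrable_Z del: of_real_diff of_real_power)
  then have "cmod ((CLINT \<omega>|M. Z u (Suc k) \<omega>) - (CLINT \<omega>|M. Z u k \<omega>)) = cmod (CLINT \<omega>|M. R \<omega>)"
    unfolding E1 E2 by simp
  also have "\<dots> \<le> expectation (\<lambda>\<omega>. cmod (R \<omega>))"
    by (rule integral_norm_bound)
  also have "\<dots> \<le> G * ((\<bar>u\<bar> * c) ^ 3 / 6 + (u\<^sup>2 * b / 2)\<^sup>2)"
  proof -
    have "\<bar>expectation (\<lambda>\<omega>. cmod (R \<omega>))\<bar> \<le> G * ((\<bar>u\<bar> * c) ^ 3 / 6 + (u\<^sup>2 * b / 2)\<^sup>2)"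
      by (rule abs_expectation_le) (simp add: R_bound)
    then show ?thesis
      by linarith
  qed
  finally show ?thesis
    unfolding G_def .
qed

text \<open>The exponential starts at 1, so the deviation is a telescoping sum of \<open>n\<close>
  one-step errors with a common bound.\<close>

lemma expectation_Z:
  "cmod ((CLINT \<omega>|M. Z u n \<omega>) - 1)
    \<le> real n * (exp (u\<^sup>2 * (real n * b) / 2) * ((\<bar>u\<bar> * c) ^ 3 / 6 + (u\<^sup>2 * b / 2)\<^sup>2))"
proof -
  have "(CLINT \<omega>|M. Z u 0 \<omega>) = 1"
    by (simp add: Z_def[abs_def] Q_def S_def prob_space)
  then have "(CLINT \<omega>|M. Z u n \<omega>) - 1 = (\<Sum>k<n. (CLINT \<omega>|M. Z u (Suc k) \<omega>) - (CLINT \<omega>|M. Z u k \<omega>))"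
    by (simp add: sum_lessThan_telescope[of "\<lambda>k. CLINT \<omega>|M. Z u k \<omega>"])
  also have "cmod \<dots> \<le> (\<Sum>k<n. exp (u\<^sup>2 * (real n * b) / 2) * ((\<bar>u\<bar> * c) ^ 3 / 6 + (u\<^sup>2 * b / 2)\<^sup>2))"
    by (rule order_trans[OF norm_sum sum_mono]) (rule Z_step, simp)
  finally show ?thesis
    by simp
qed

text \<open>With \<open>u = t / sqrt n\<close> the exponential prefactor becomes the constant
  \<open>G\<close>, and the accumulated error is of order \<open>n^(-1/2)\<close>, so
  \<open>z\<close> tends to 1. Replacing the compensator inside the expectation by its limit
  \<open>E\<close> costs at most the expectation of \<open>\<bar>D n\<bar>\<close>, which vanishes
  by bounded convergence in probability. Dividing by \<open>E\<close> leaves the characteristic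
  function.\<close>

theorem central_limit:
  assumes conv: "tendsto_in_prob M (\<lambda>n \<omega>. Q n \<omega> / real n) v"
  shows "(\<lambda>n. CLINT \<omega>|M. iexp (t * (S n \<omega> / sqrt (real n)))) \<longlonglongrightarrow> exp (- (t\<^sup>2) * v / 2)"
proof -
  define E where "E = exp (t\<^sup>2 * v / 2)"
  define G where "G = exp (t\<^sup>2 * b / 2)"
  define z where "z n = (CLINT \<omega>|M. Z (t / sqrt (real n)) n \<omega>)" for n
  define D where "D n \<omega> = exp (t\<^sup>2 / 2 * (Q n \<omega> / real n)) - E" for n \<omega>
  have z_lim: "z \<longlonglongrightarrow> 1"
  proof (rule Lim_transform)
    show "(\<lambda>n. z n - 1) \<longlonglongrightarrow> 0"
    proof (rule Lim_null_comparison)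
      show "(\<lambda>n. G * (\<bar>t\<bar> ^ 3 * c ^ 3 / 6 / sqrt (real n) + (t\<^sup>2 * b / 2)\<^sup>2 / real n)) \<longlonglongrightarrow> 0"
        by (rule tendsto_mult_right_zero) real_asymp
      show "\<forall>\<^sub>F n in sequentially. norm (z n - 1)
          \<le> G * (\<bar>t\<bar> ^ 3 * c ^ 3 / 6 / sqrt (real n) + (t\<^sup>2 * b / 2)\<^sup>2 / real n)"
        using eventually_gt_at_top[of 0]
      proof eventually_elim
        case (elim n)
        define s where "s = sqrt (real n)"
        have s: "0 < s" "real n = s\<^sup>2"
          using elim by (auto simp: s_def)
        have "norm (z n - 1) \<le> real n * (exp ((t / s)\<^sup>2 * (real n * b) / 2)
            * ((\<bar>t / s\<bar> * c) ^ 3 / 6 + ((t / s)\<^sup>2 * b / 2)\<^sup>2))"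
          unfolding z_def s_def by (rule expectation_Z)
        also have "(t / s)\<^sup>2 * (real n * b) / 2 = t\<^sup>2 * b / 2"
          using s(1) unfolding s(2) by (simp add: power_divide)
        also have "real n * (exp (t\<^sup>2 * b / 2) * ((\<bar>t / s\<bar> * c) ^ 3 / 6 + ((t / s)\<^sup>2 * b / 2)\<^sup>2))
            = G * (\<bar>t\<bar> ^ 3 * c ^ 3 / 6 / s + (t\<^sup>2 * b / 2)\<^sup>2 / real n)"
          using s(1) unfolding s(2) G_def
          by (simp add: field_simps power2_eq_square power3_eq_cube abs_divide)
        finally show ?case
          unfolding s_def .
      qed
    qed
  qed simp
  have "isCont (\<lambda>x. exp (t\<^sup>2 / 2 * x) - E) v"
    by (intro continuous_intros)
  from tendsto_in_prob_isCont[OF _ conv this]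
  have D_prob: "tendsto_in_prob M D 0"
    unfolding D_def[abs_def] by (simp add: E_def)
  have D_meas[measurable]: "D n \<in> borel_measurable M" for n
    unfolding D_def[abs_def] by measurable
  have D_bound: "\<bar>D n \<omega>\<bar> \<le> G + E" if \<omega>: "\<omega> \<in> space M" for n \<omega>
  proof -
    have "Q n \<omega> / real n \<le> b"
      using Q_bound[OF \<omega>, of n] b_nonneg by (cases "n = 0") (auto simp: divide_le_eq mult.commute)
    then have "exp (t\<^sup>2 / 2 * (Q n \<omega> / real n)) \<le> G"
      unfolding G_def using mult_left_mono[of "Q n \<omega> / real n" b "t\<^sup>2 / 2"] by simp
    moreover have "0 < exp (t\<^sup>2 / 2 * (Q n \<omega> / real n))" "0 < E"
      by (simp_all add: E_def)
    ultimately show ?thesis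
      unfolding D_def by linarith
  qed
  have D_lim: "(\<lambda>n. expectation (\<lambda>\<omega>. \<bar>D n \<omega>\<bar>)) \<longlonglongrightarrow> 0"
    by (rule tendsto_in_prob_imp_expectation[OF D_meas D_prob]) (use D_bound in blast)
  let ?\<phi> = "\<lambda>n. CLINT \<omega>|M. iexp (t * (S n \<omega> / sqrt (real n)))"
  have "(\<lambda>n. z n - E * ?\<phi> n) \<longlonglongrightarrow> 0"
  proof (rule Lim_null_comparison[OF _ D_lim])
    show "\<forall>\<^sub>F n in sequentially. norm (z n - E * ?\<phi> n) \<le> expectation (\<lambda>\<omega>. \<bar>D n \<omega>\<bar>)"
      using eventually_gt_at_top[of 0]
    proof eventually_elim
      case (elim n)
      have int: "complex_integrable M (\<lambda>\<omega>. iexp (t * (S n \<omega> / sqrt (real n))))"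
        by (rule integrable_const_bound[where B=1]) auto
      have "Z (t / sqrt (real n)) n \<omega> - E * iexp (t * (S n \<omega> / sqrt (real n)))
          = D n \<omega> * iexp (t * (S n \<omega> / sqrt (real n)))" for \<omega>
        using elim by (simp add: Z_def D_def power_divide algebra_simps)
      moreover have "z n - E * ?\<phi> n
          = (CLINT \<omega>|M. Z (t / sqrt (real n)) n \<omega> - E * iexp (t * (S n \<omega> / sqrt (real n))))"
        unfolding z_def using int integrable_Z by simp
      ultimately have "z n - E * ?\<phi> n = (CLINT \<omega>|M. D n \<omega> * iexp (t * (S n \<omega> / sqrt (real n))))"
        by simp
      also have "norm \<dots> \<le> expectation (\<lambda>\<omega>. cmod (D n \<omega> * iexp (t * (S n \<omega> / sqrt (real n)))))"
        by (rule integral_norm_bound)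
      finally show ?case
        by (simp add: norm_mult)
    qed
  qed
  from tendsto_diff[OF z_lim this] have "(\<lambda>n. E * ?\<phi> n) \<longlonglongrightarrow> 1"
    by simp
  then have "(\<lambda>n. complex_of_real (inverse E) * (E * ?\<phi> n)) \<longlonglongrightarrow> complex_of_real (inverse E) * 1"
    by (intro tendsto_mult tendsto_const)
  moreover have "complex_of_real (inverse E) * (E * w) = w" for w :: complex
    by (simp add: E_def)
  moreover have "inverse E = exp (- (t\<^sup>2) * v / 2)"
    by (simp add: E_def exp_minus[symmetric])
  ultimately show ?thesis
    by (simp only: mult_1_right)
qed

end

section \<open>The adaptive chain\<close>

text \<open>Pushing \<open>\<kappa> x\<close> forward along \<open>y \<mapsto> (x, y)\<close> gives
  a kernel into the product, which reduces an integrand depending on \<open>x\<close> to a fixed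
  one.\<close>

lemma integral_measurable_kernel:
  fixes h :: "'a \<times> 'b \<Rightarrow> real" and L :: "'a measure" and N :: "'b measure"
  assumes \<kappa>: "\<kappa> \<in> L \<rightarrow>\<^sub>M prob_algebra N" and h: "h \<in> borel_measurable (L \<Otimes>\<^sub>M N)"
  shows "(\<lambda>x. \<integral>y. h (x, y) \<partial>\<kappa> x) \<in> borel_measurable L"
proof -
  have [measurable]: "(\<lambda>x. distr (\<kappa> x) (L \<Otimes>\<^sub>M N) (\<lambda>y. (x, y))) \<in> L \<rightarrow>\<^sub>M prob_algebra (L \<Otimes>\<^sub>M N)"
    by (rule measurable_distr_prob_space2[OF \<kappa>]) simp
  have "(\<lambda>x. \<integral>p. h p \<partial>distr (\<kappa> x) (L \<Otimes>\<^sub>M N) (\<lambda>y. (x, y))) \<in> borel_measurable L"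
    by (rule integral_kernel_measurable[OF _ h]) measurable
  moreover have "(\<integral>p. h p \<partial>distr (\<kappa> x) (L \<Otimes>\<^sub>M N) (\<lambda>y. (x, y))) = (\<integral>y. h (x, y) \<partial>\<kappa> x)"
    if x: "x \<in> space L" for x
  proof (rule integral_distr[OF _ h])
    show "Pair x \<in> \<kappa> x \<rightarrow>\<^sub>M L \<Otimes>\<^sub>M N"
      unfolding measurable_cong_sets[OF kernel_prob_space(2)[OF \<kappa> x] refl]
      by (rule measurable_Pair1'[OF x])
  qed
  ultimately show ?thesis
    by (rule measurable_cong[THEN iffD1, rotated])
qed

locale adaptive_markov_chain = prob_space M
  for M :: "'w measure" +
  fixes F :: "nat \<Rightarrow> 'w measure" and XX :: "'x measure" and SS :: "'s measure"
    and \<pi> :: "'x measure" and P :: "'s \<Rightarrow> 'x \<Rightarrow> 'x measure"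
    and S :: "nat \<Rightarrow> 'w \<Rightarrow> 's" and X :: "nat \<Rightarrow> 'w \<Rightarrow> 'x"
    and \<phi> :: "'x \<Rightarrow> real" and B C \<rho> :: real
  assumes prob_\<pi>: "prob_space \<pi>" and sets_\<pi>: "sets \<pi> = sets XX"
    and kernel: "\<And>s. s \<in> space SS \<Longrightarrow> P s \<in> XX \<rightarrow>\<^sub>M prob_algebra XX"
    and invariant: "\<And>s. s \<in> space SS \<Longrightarrow> Giry_Monad.bind \<pi> (P s) = \<pi>"
    and joint_measurable: "\<And>A. A \<in> sets XX \<Longrightarrow>
      (\<lambda>(s, x). measure (P s x) A) \<in> borel_measurable (SS \<Otimes>\<^sub>M XX)"
    and filtration: "filtration (space M) F" and subalg: "\<And>k. subalgebra M (F k)"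
    and S_adapted: "\<And>k. S k \<in> F k \<rightarrow>\<^sub>M SS"
    and X_adapted: "\<And>k. X k \<in> F k \<rightarrow>\<^sub>M XX"
    and transition: "\<And>k A. A \<in> sets XX \<Longrightarrow>
      AE \<omega> in M. real_cond_exp M (F k) (indicator {\<omega>\<in>space M. X (Suc k) \<omega> \<in> A}) \<omega>
        = measure (P (S k \<omega>) (X k \<omega>)) A"
    and \<rho>: "0 \<le> \<rho>" "\<rho> < 1"
    and ergodic: "\<And>s x k. s \<in> space SS \<Longrightarrow> x \<in> space XX \<Longrightarrow>
      tv_dist (kernel_power XX (P s) k x) \<pi> \<le> C * \<rho> ^ k"
    and \<phi>: "\<phi> \<in> borel_measurable XX" "\<And>x. x \<in> space XX \<Longrightarrow> \<bar>\<phi> x\<bar> \<le> B"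
begin

section \<open>Joint measurability and the Markov property with a random parameter\<close>

lemma ergodic_kernel: "s \<in> space SS \<Longrightarrow> ergodic_kernel XX \<pi> (P s) C \<rho>"
  by (rule ergodic_kernel.intro[OF prob_\<pi> sets_\<pi> kernel invariant \<rho> ergodic])

lemma S_measurable[measurable]: "S k \<in> M \<rightarrow>\<^sub>M SS"
  by (rule measurable_from_subalg[OF subalg S_adapted])

lemma X_measurable[measurable]: "X k \<in> M \<rightarrow>\<^sub>M XX"
  by (rule measurable_from_subalg[OF subalg X_adapted])

lemma space_F: "space (F k) = space M"
  using subalg by (simp add: subalgebra_def)

lemma S_space: "\<omega> \<in> space M \<Longrightarrow> S k \<omega> \<in> space SS"
  by (rule measurable_space[OF S_measurable])

lemma X_space: "\<omega> \<in> space M \<Longrightarrow> X k \<omega> \<in> space XX"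
  by (rule measurable_space[OF X_measurable])

lemma F_mono: "i \<le> j \<Longrightarrow> subalgebra (F j) (F i)"
  using filtration by (simp add: subalgebra_def filtration_def)

text \<open>Event-by-event measurability suffices because the sigma-algebra on probability measures
  is generated by evaluations. The joint form is needed since both the parameter and the state will
  be random.\<close>

lemma joint_kernel: "(\<lambda>p. P (fst p) (snd p)) \<in> SS \<Otimes>\<^sub>M XX \<rightarrow>\<^sub>M prob_algebra XX"
proof (rule measurable_prob_algebraI)
  have prob: "prob_space (P (fst p) (snd p))" "sets (P (fst p) (snd p)) = sets XX"
    if "p \<in> space (SS \<Otimes>\<^sub>M XX)" for p
    using that kernel_prob_space[OF kernel] by (auto simp: space_pair_measure)
  then show "p \<in> space (SS \<Otimes>\<^sub>M XX) \<Longrightarrow> prob_space (P (fst p) (snd p))" for p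
    by simp
  show "(\<lambda>p. P (fst p) (snd p)) \<in> SS \<Otimes>\<^sub>M XX \<rightarrow>\<^sub>M subprob_algebra XX"
  proof (rule measurable_subprob_algebra)
    show "p \<in> space (SS \<Otimes>\<^sub>M XX) \<Longrightarrow> subprob_space (P (fst p) (snd p))" for p
      using prob by (simp add: prob_space_imp_subprob_space)
    show "p \<in> space (SS \<Otimes>\<^sub>M XX) \<Longrightarrow> sets (P (fst p) (snd p)) = sets XX" for p
      using prob by simp
    fix A assume A: "A \<in> sets XX"
    have "(\<lambda>p. ennreal (measure (P (fst p) (snd p)) A)) \<in> borel_measurable (SS \<Otimes>\<^sub>M XX)"
      using joint_measurable[OF A] by (simp add: case_prod_unfold)
    then show "(\<lambda>p. emeasure (P (fst p) (snd p)) A) \<in> borel_measurable (SS \<Otimes>\<^sub>M XX)"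
      by (rule measurable_cong[THEN iffD1, rotated])
         (metis prob(1) finite_measure.emeasure_eq_measure prob_space_def)
  qed
qed

text \<open>The transition added in the induction keeps the parameter \<open>fst p\<close> and
  replaces only the state, so it is viewed as a kernel on the old pair together with the current
  state.\<close>

lemma joint_kernel_power:
  "(\<lambda>p. kernel_power XX (P (fst p)) n (snd p)) \<in> SS \<Otimes>\<^sub>M XX \<rightarrow>\<^sub>M prob_algebra XX"
proof (induction n)
  case 0
  show ?case
    using measurable_compose[OF measurable_snd measurable_return_prob_space] by simp
next
  case (Suc n)
  have "(\<lambda>q. (fst (fst q), snd q)) \<in> (SS \<Otimes>\<^sub>M XX) \<Otimes>\<^sub>M XX \<rightarrow>\<^sub>M SS \<Otimes>\<^sub>M XX"
    by measurable
  from measurable_compose[OF this joint_kernel]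
  have "(\<lambda>(p, y). P (fst p) y) \<in> (SS \<Otimes>\<^sub>M XX) \<Otimes>\<^sub>M XX \<rightarrow>\<^sub>M prob_algebra XX"
    by (simp add: case_prod_unfold)
  from measurable_bind_prob_space2[OF Suc this] show ?case
    by simp
qed

abbreviation g :: "'s \<Rightarrow> 'x \<Rightarrow> real" where
  "g s \<equiv> poisson_sol XX \<pi> (P s) \<phi>"

text \<open>Measurability of each single \<open>g s\<close> would not do: the solution is evaluated
  at the random parameter \<open>S k\<close>.\<close>

lemma g_measurable[measurable]: "(\<lambda>p. g (fst p) (snd p)) \<in> borel_measurable (SS \<Otimes>\<^sub>M XX)"
proof -
  let ?f = "\<lambda>y. \<phi> y - (\<integral>z. \<phi> z \<partial>\<pi>)"
  have "(\<lambda>p. \<integral>y. ?f y \<partial>kernel_power XX (P (fst p)) n (snd p)) \<in> borel_measurable (SS \<Otimes>\<^sub>M XX)" for n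
    by (rule integral_kernel_measurable[OF joint_kernel_power]) (use \<phi>(1) in measurable)
  then have "(\<lambda>p. \<Sum>n. \<integral>y. ?f y \<partial>kernel_power XX (P (fst p)) n (snd p))
      \<in> borel_measurable (SS \<Otimes>\<^sub>M XX)"
    by (rule borel_measurable_suminf)
  then show ?thesis
    by (simp add: poisson_sol_def kernel_app_def)
qed

definition G :: real where
  "G = 4 * B * C / (1 - \<rho>)"

lemma g_bound: "s \<in> space SS \<Longrightarrow> x \<in> space XX \<Longrightarrow> \<bar>g s x\<bar> \<le> G"
  unfolding G_def by (rule ergodic_kernel.poisson_sol_bound[OF ergodic_kernel \<phi>])

lemma g_section_measurable: "s \<in> space SS \<Longrightarrow> g s \<in> borel_measurable XX"
  by (rule ergodic_kernel.poisson_sol_measurable[OF ergodic_kernel \<phi>])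

lemma G_nonneg: "0 \<le> G"
proof -
  obtain \<omega> where "\<omega> \<in> space M"
    using not_empty by blast
  from order_trans[OF abs_ge_zero g_bound[OF S_space[OF this] X_space[OF this]]]
  show ?thesis .
qed

text \<open>By \<open>transition\<close> this kernel is the regular conditional law of
  \<open>X (Suc k)\<close> given \<open>F k\<close>.\<close>

lemma path_kernel: "(\<lambda>\<omega>. P (S k \<omega>) (X k \<omega>)) \<in> F k \<rightarrow>\<^sub>M prob_algebra XX"
  using measurable_compose[OF measurable_Pair[OF S_adapted X_adapted] joint_kernel] by simp

text \<open>\<open>transition\<close> concerns one fixed event at a time, whereas \<open>H\<close>
  may depend on the past through \<open>\<omega>\<close>. Both sides are integrals of
  \<open>H\<close>: against the joint law of \<open>\<omega>\<close> and \<open>X (Suc k)\<close>,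
  and against the law that draws \<open>\<omega>\<close> first and then the state from the kernel.
  On rectangles the two laws agree by \<open>transition\<close>, hence they agree
  everywhere.\<close>

lemma expectation_next_state:
  fixes H :: "'w \<times> 'x \<Rightarrow> real"
  assumes H: "H \<in> borel_measurable (F k \<Otimes>\<^sub>M XX)"
    and H_bound: "\<And>\<omega> y. \<omega> \<in> space M \<Longrightarrow> y \<in> space XX \<Longrightarrow> \<bar>H (\<omega>, y)\<bar> \<le> d"
  shows "expectation (\<lambda>\<omega>. H (\<omega>, X (Suc k) \<omega>))
    = expectation (\<lambda>\<omega>. \<integral>y. H (\<omega>, y) \<partial>P (S k \<omega>) (X k \<omega>))"
proof -
  \<comment> \<open>The first coordinate carries \<open>F k\<close> instead of \<open>M\<close>:
    then the sides of rectangles are events of the past, as conditioning on \<open>F k\<close>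
    requires.\<close>
  let ?FX = "F k \<Otimes>\<^sub>M XX" and ?N = "restr_to_subalg M (F k)"
  let ?\<kappa> = "\<lambda>\<omega>. P (S k \<omega>) (X k \<omega>)"
  \<comment> \<open>\<open>L \<omega>\<close> is the product of the point mass at
    \<open>\<omega>\<close> with the transition law. Retaining \<open>\<omega>\<close> lets the
    two-stage experiment be written as a bind into the product space.\<close>
  define L where "L \<omega> = distr (?\<kappa> \<omega>) ?FX (\<lambda>y. (\<omega>, y))" for \<omega>
  interpret fin: sigma_finite_subalgebra M "F k"
    by (rule finite_measure_subalgebra_is_sigma_finite)
       (simp add: finite_measure_subalgebra_def finite_measure_subalgebra_axioms_def subalg finite_measure_axioms)
  interpret N: prob_space ?N
    by (rule prob_space_restr_to_subalg[OF subalg]) unfold_locales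
  have sets_N: "sets ?N = sets (F k)"
    by (rule sets_restr_to_subalg[OF subalg])
  have L: "L \<in> F k \<rightarrow>\<^sub>M prob_algebra ?FX"
    unfolding L_def by (rule measurable_distr_prob_space2[OF path_kernel]) simp
  have Pair_\<kappa>: "Pair \<omega> \<in> ?\<kappa> \<omega> \<rightarrow>\<^sub>M ?FX" if "\<omega> \<in> space M" for \<omega>
  proof -
    have sets_\<kappa>: "sets (?\<kappa> \<omega>) = sets XX"
      by (rule kernel_prob_space(2)[OF path_kernel]) (simp add: that space_F)
    have "Pair \<omega> \<in> XX \<rightarrow>\<^sub>M ?FX"
      by (rule measurable_Pair1') (simp add: that space_F)
    then show ?thesis
      unfolding measurable_cong_sets[OF sets_\<kappa> refl] .
  qed
  have id_meas[measurable]: "(\<lambda>\<omega>. \<omega>) \<in> M \<rightarrow>\<^sub>M F k"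
    by (rule measurable_from_subalg[OF subalg measurable_ident_sets[OF refl]])
  have XS[measurable]: "(\<lambda>\<omega>. (\<omega>, X (Suc k) \<omega>)) \<in> M \<rightarrow>\<^sub>M ?FX"
    by measurable
  define \<mu>1 where "\<mu>1 = distr M ?FX (\<lambda>\<omega>. (\<omega>, X (Suc k) \<omega>))"
  define \<mu>2 where "\<mu>2 = Giry_Monad.bind ?N L"
  have L': "L \<in> ?N \<rightarrow>\<^sub>M prob_algebra ?FX"
    using L unfolding measurable_cong_sets[OF sets_N refl] .
  interpret \<mu>1: prob_space \<mu>1
    unfolding \<mu>1_def by (rule prob_space_distr) measurable
  interpret \<mu>2: prob_space \<mu>2
    unfolding \<mu>2_def by (rule prob_space_bind'[OF _ L']) (simp add: space_prob_algebra N.prob_space_axioms)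
  have sets_\<mu>2: "sets \<mu>2 = sets ?FX"
    unfolding \<mu>2_def by (rule sets_bind'[OF _ L']) (simp add: space_prob_algebra N.prob_space_axioms)
  have "\<mu>1 = \<mu>2"
  proof (rule measure_eqI_generator_eq[OF Int_stable_pair_measure_generator[of "F k" XX]])
    let ?E = "{a \<times> b |a b. a \<in> sets (F k) \<and> b \<in> sets XX}"
    show "?E \<subseteq> Pow (space (F k) \<times> space XX)"
      by (auto dest: sets.sets_into_space)
    show "sets \<mu>1 = sigma_sets (space (F k) \<times> space XX) ?E"
      by (simp add: \<mu>1_def sets_pair_measure)
    show "sets \<mu>2 = sigma_sets (space (F k) \<times> space XX) ?E"
      by (simp add: sets_\<mu>2 sets_pair_measure)
    show "range (\<lambda>_::nat. space (F k) \<times> space XX) \<subseteq> ?E"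
      by auto
    fix R assume "R \<in> ?E"
    then obtain a b where R: "R = a \<times> b" and a: "a \<in> sets (F k)" and b: "b \<in> sets XX"
      by blast
    have a': "a \<in> sets M"
      using a subalg by (auto simp: subalgebra_def)
    note [measurable] = a a' b
    let ?ind = "indicator {\<omega>\<in>space M. X (Suc k) \<omega> \<in> b} :: 'w \<Rightarrow> real"
    have int: "integrable M (\<lambda>\<omega>. indicator a \<omega> * ?ind \<omega>)"
      by (rule integrable_of_bounded[where B=1]) (auto simp: indicator_def)
    have "measure \<mu>1 R = measure M ((\<lambda>\<omega>. (\<omega>, X (Suc k) \<omega>)) -` R \<inter> space M)"
      unfolding \<mu>1_def R by (rule measure_distr[OF XS]) measurable
    also have "\<dots> = (\<integral>\<omega>. indicator ((\<lambda>\<omega>. (\<omega>, X (Suc k) \<omega>)) -` R \<inter> space M) \<omega> \<partial>M)"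
      by simp
    also have "\<dots> = (\<integral>\<omega>. indicator a \<omega> * ?ind \<omega> \<partial>M)"
      by (intro Bochner_Integration.integral_cong) (auto simp: R indicator_def)
    also have "\<dots> = (\<integral>\<omega>. indicator a \<omega> * real_cond_exp M (F k) ?ind \<omega> \<partial>M)"
      by (rule fin.real_cond_exp_intg(2)[OF int, symmetric]) measurable
    also have "\<dots> = (\<integral>\<omega>. indicator a \<omega> * measure (?\<kappa> \<omega>) b \<partial>M)"
    proof (rule integral_cong_AE)
      have "(\<lambda>\<omega>. measure (?\<kappa> \<omega>) b) \<in> borel_measurable M"
        by (rule measurable_from_subalg[OF subalg])
           (rule measurable_compose[OF path_kernel measurable_measure_prob_algebra[OF b]])
      then show "(\<lambda>\<omega>. indicator a \<omega> * measure (?\<kappa> \<omega>) b) \<in> borel_measurable M"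
        by measurable
      show "AE \<omega> in M. indicator a \<omega> * real_cond_exp M (F k) ?ind \<omega> = indicator a \<omega> * measure (?\<kappa> \<omega>) b"
        using transition[OF b, of k] by eventually_elim simp
    qed measurable
    also have "\<dots> = (\<integral>\<omega>. indicator a \<omega> * measure (?\<kappa> \<omega>) b \<partial>?N)"
    proof (rule integral_subalgebra2[OF subalg, symmetric])
      have "(\<lambda>\<omega>. measure (?\<kappa> \<omega>) b) \<in> borel_measurable (F k)"
        by (rule measurable_compose[OF path_kernel measurable_measure_prob_algebra[OF b]])
      then show "(\<lambda>\<omega>. indicator a \<omega> * measure (?\<kappa> \<omega>) b) \<in> borel_measurable (F k)"
        by measurable
    qed
    also have "\<dots> = (\<integral>\<omega>. measure (L \<omega>) R \<partial>?N)"
    proof (intro Bochner_Integration.integral_cong refl)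
      fix \<omega> assume "\<omega> \<in> space ?N"
      then have \<omega>: "\<omega> \<in> space M"
        by (simp add: space_restr_to_subalg)
      have "measure (L \<omega>) R = measure (?\<kappa> \<omega>) (Pair \<omega> -` R \<inter> space (?\<kappa> \<omega>))"
        unfolding L_def R by (rule measure_distr[OF Pair_\<kappa>[OF \<omega>]]) measurable
      also have "Pair \<omega> -` R \<inter> space (?\<kappa> \<omega>) = (if \<omega> \<in> a then b else {})"
        using kernel_prob_space(3)[OF path_kernel, of \<omega> k] \<omega> sets.sets_into_space[OF b]
        by (auto simp: R space_F)
      finally show "indicator a \<omega> * measure (?\<kappa> \<omega>) b = measure (L \<omega>) R"
        by simp
    qed
    also have "\<dots> = measure \<mu>2 R"
      unfolding \<mu>2_def R
      by (rule subprob_space.measure_bind[symmetric, OF _ measurable_prob_algebraD[OF L']])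
         (auto intro: prob_space_imp_subprob_space N.prob_space_axioms)
    finally show "emeasure \<mu>1 R = emeasure \<mu>2 R"
      by (simp add: \<mu>1.emeasure_eq_measure \<mu>2.emeasure_eq_measure)
  qed (simp_all add: \<mu>1.emeasure_eq_measure)
  have H_bound': "\<And>p. p \<in> space ?FX \<Longrightarrow> \<bar>H p\<bar> \<le> d"
    using H_bound by (auto simp: space_pair_measure space_F)
  have "expectation (\<lambda>\<omega>. H (\<omega>, X (Suc k) \<omega>)) = (\<integral>p. H p \<partial>\<mu>1)"
    unfolding \<mu>1_def by (rule integral_distr[OF XS H, symmetric])
  also have "\<dots> = (\<integral>\<omega>. \<integral>p. H p \<partial>L \<omega> \<partial>?N)"
    unfolding \<open>\<mu>1 = \<mu>2\<close> \<mu>2_def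
    by (rule integral_bind_kernel[OF N.prob_space_axioms sets_N L H H_bound'])
  also have "\<dots> = (\<integral>\<omega>. \<integral>p. H p \<partial>L \<omega> \<partial>M)"
    by (rule integral_subalgebra2[OF subalg integral_kernel_measurable[OF L H]])
  also have "\<dots> = expectation (\<lambda>\<omega>. \<integral>y. H (\<omega>, y) \<partial>?\<kappa> \<omega>)"
    by (intro Bochner_Integration.integral_cong refl)
       (simp add: L_def integral_distr[OF Pair_\<kappa> H])
  finally show ?thesis .
qed

lemma expectation_weighted_next_state:
  fixes h :: "'s \<times> 'x \<Rightarrow> real"
  assumes W: "W \<in> borel_measurable (F k)" "\<And>\<omega>. \<omega> \<in> space M \<Longrightarrow> \<bar>W \<omega>\<bar> \<le> b"
    and h: "h \<in> borel_measurable (SS \<Otimes>\<^sub>M XX)"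
      "\<And>s y. s \<in> space SS \<Longrightarrow> y \<in> space XX \<Longrightarrow> \<bar>h (s, y)\<bar> \<le> d"
  shows "expectation (\<lambda>\<omega>. W \<omega> * h (S k \<omega>, X (Suc k) \<omega>))
    = expectation (\<lambda>\<omega>. W \<omega> * kernel_app (P (S k \<omega>)) (\<lambda>y. h (S k \<omega>, y)) (X k \<omega>))"
proof -
  note [measurable] = W(1) h(1) S_adapted[of k]
  have "expectation (\<lambda>\<omega>. case (\<omega>, X (Suc k) \<omega>) of (\<omega>, y) \<Rightarrow> W \<omega> * h (S k \<omega>, y))
    = expectation (\<lambda>\<omega>. \<integral>y. (case (\<omega>, y) of (\<omega>, y) \<Rightarrow> W \<omega> * h (S k \<omega>, y)) \<partial>P (S k \<omega>) (X k \<omega>))"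
  proof (rule expectation_next_state)
    show "(\<lambda>(\<omega>, y). W \<omega> * h (S k \<omega>, y)) \<in> borel_measurable (F k \<Otimes>\<^sub>M XX)"
      by measurable
    fix \<omega> y assume \<omega>: "\<omega> \<in> space M" and y: "y \<in> space XX"
    show "\<bar>case (\<omega>, y) of (\<omega>, y) \<Rightarrow> W \<omega> * h (S k \<omega>, y)\<bar> \<le> b * d"
      using W(2)[OF \<omega>] h(2)[OF S_space[OF \<omega>] y] by (auto simp: abs_mult intro!: mult_mono)
  qed
  then show ?thesis
    by (simp add: kernel_app_def)
qed

section \<open>Martingale differences from the Poisson solutions, with their conditional
  moments\<close>

lemma kernel_app_path_measurable:
  assumes h: "h \<in> borel_measurable (SS \<Otimes>\<^sub>M XX)"
  shows "(\<lambda>\<omega>. kernel_app (P (S k \<omega>)) (\<lambda>y. h (S k \<omega>, y)) (X k \<omega>)) \<in> borel_measurable (F k)"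
proof -
  note [measurable] = h S_adapted[of k]
  have "(\<lambda>(\<omega>, y). h (S k \<omega>, y)) \<in> borel_measurable (F k \<Otimes>\<^sub>M XX)"
    by measurable
  from integral_measurable_kernel[OF path_kernel this] show ?thesis
    by (simp add: kernel_app_def)
qed

text \<open>The conditional mean of \<open>g (S k) (X (Suc k))\<close> given \<open>F k\<close>; the
  same quantities also form the telescoping part of the decomposition.\<close>

definition m :: "nat \<Rightarrow> 'w \<Rightarrow> real" where
  "m k \<omega> = kernel_app (P (S k \<omega>)) (g (S k \<omega>)) (X k \<omega>)"

definition \<xi> :: "nat \<Rightarrow> 'w \<Rightarrow> real" where
  "\<xi> k \<omega> = g (S k \<omega>) (X (Suc k) \<omega>) - m k \<omega>"

text \<open>The conditional variance of \<open>\<xi> k\<close> given \<open>F k\<close>, and the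
  summand of the variance hypothesis at index \<open>k + 1\<close>.\<close>

definition V :: "nat \<Rightarrow> 'w \<Rightarrow> real" where
  "V k \<omega> = kernel_app (P (S k \<omega>)) (\<lambda>y. (g (S k \<omega>) y)\<^sup>2) (X k \<omega>) - (m k \<omega>)\<^sup>2"

lemma m_adapted: "m k \<in> borel_measurable (F k)"
  using kernel_app_path_measurable[OF g_measurable] by (simp add: m_def[abs_def])

lemma m_bound: "\<omega> \<in> space M \<Longrightarrow> \<bar>m k \<omega>\<bar> \<le> G"
  unfolding m_def by (rule kernel_app_bound[OF kernel[OF S_space] g_bound[OF S_space] X_space])

lemma g_path_measurable: "(\<lambda>\<omega>. g (S i \<omega>) (X j \<omega>)) \<in> borel_measurable M"
  using measurable_compose[OF measurable_Pair[OF S_measurable[of i] X_measurable[of j]] g_measurable]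
  by simp

lemma square_le_square_bound: "\<bar>x\<bar> \<le> G \<Longrightarrow> x\<^sup>2 \<le> G\<^sup>2"
  using abs_le_square_iff[of x G] G_nonneg by simp

text \<open>Conditional first and second moments of \<open>g (S k) (X (Suc k))\<close>: the term
  \<open>V k + (m k)^2\<close> is the kernel applied to the square of
  \<open>g (S k)\<close>.\<close>

lemma expectation_weighted_g:
  assumes W: "W \<in> borel_measurable (F k)" "\<And>\<omega>. \<omega> \<in> space M \<Longrightarrow> \<bar>W \<omega>\<bar> \<le> b"
  shows "expectation (\<lambda>\<omega>. W \<omega> * g (S k \<omega>) (X (Suc k) \<omega>)) = expectation (\<lambda>\<omega>. W \<omega> * m k \<omega>)"
    and "expectation (\<lambda>\<omega>. W \<omega> * (g (S k \<omega>) (X (Suc k) \<omega>))\<^sup>2)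
      = expectation (\<lambda>\<omega>. W \<omega> * (V k \<omega> + (m k \<omega>)\<^sup>2))"
proof -
  show "expectation (\<lambda>\<omega>. W \<omega> * g (S k \<omega>) (X (Suc k) \<omega>)) = expectation (\<lambda>\<omega>. W \<omega> * m k \<omega>)"
    using expectation_weighted_next_state[OF W g_measurable, of G] g_bound by (simp add: m_def)
  have "(\<lambda>p. (g (fst p) (snd p))\<^sup>2) \<in> borel_measurable (SS \<Otimes>\<^sub>M XX)"
    by measurable
  from expectation_weighted_next_state[OF W this, of "G\<^sup>2"]
  show "expectation (\<lambda>\<omega>. W \<omega> * (g (S k \<omega>) (X (Suc k) \<omega>))\<^sup>2)
      = expectation (\<lambda>\<omega>. W \<omega> * (V k \<omega> + (m k \<omega>)\<^sup>2))"
    using square_le_square_bound[OF g_bound] by (simp add: V_def)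
qed

lemma integrable_mult_bounded:
  assumes "U \<in> borel_measurable M" "\<And>\<omega>. \<omega> \<in> space M \<Longrightarrow> \<bar>U \<omega>\<bar> \<le> a"
    and "Y \<in> borel_measurable M" "\<And>\<omega>. \<omega> \<in> space M \<Longrightarrow> \<bar>Y \<omega>\<bar> \<le> d"
  shows "integrable M (\<lambda>\<omega>. U \<omega> * Y \<omega> :: real)"
proof (rule integrable_of_bounded)
  show "(\<lambda>\<omega>. U \<omega> * Y \<omega>) \<in> borel_measurable M"
    using assms by measurable
  show "\<bar>U \<omega> * Y \<omega>\<bar> \<le> a * d" if "\<omega> \<in> space M" for \<omega>
    using assms(2,4)[OF that] by (auto simp: abs_mult intro!: mult_mono)
qed

text \<open>\<open>V k\<close> is the variance of \<open>g (S k)\<close> under the transition law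
  from the current state, hence nonnegative; dropping the subtracted square gives the upper
  bound.\<close>

lemma V_bound:
  assumes \<omega>: "\<omega> \<in> space M"
  shows "0 \<le> V k \<omega> \<and> V k \<omega> \<le> G\<^sup>2"
proof -
  note K = kernel[OF S_space[OF \<omega>, of k]] and x = X_space[OF \<omega>, of k]
  interpret \<kappa>: prob_space "P (S k \<omega>) (X k \<omega>)"
    by (rule kernel_prob_space(1)[OF K x])
  note gm = g_section_measurable[OF S_space[OF \<omega>, of k]] and gb = g_bound[OF S_space[OF \<omega>, of k]]
  have g2m: "(\<lambda>y. (g (S k \<omega>) y)\<^sup>2) \<in> borel_measurable XX"
    using gm by measurable
  have g2b: "\<bar>(g (S k \<omega>) y)\<^sup>2\<bar> \<le> G\<^sup>2" if "y \<in> space XX" for y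
    using square_le_square_bound[OF gb[OF that]] by simp
  have i1: "integrable (P (S k \<omega>) (X k \<omega>)) (g (S k \<omega>))"
    by (rule kernel_integrable[OF K gm gb x])
  have i2: "integrable (P (S k \<omega>) (X k \<omega>)) (\<lambda>y. (g (S k \<omega>) y)\<^sup>2)"
    by (rule kernel_integrable[OF K g2m g2b x])
  have "V k \<omega> = \<kappa>.variance (g (S k \<omega>))"
    unfolding V_def m_def kernel_app_def by (rule \<kappa>.variance_eq[OF i1 i2, symmetric])
  then have "0 \<le> V k \<omega>"
    by simp
  moreover have "\<bar>kernel_app (P (S k \<omega>)) (\<lambda>y. (g (S k \<omega>) y)\<^sup>2) (X k \<omega>)\<bar> \<le> G\<^sup>2"
    by (rule kernel_app_bound[OF K g2b x])
  then have "V k \<omega> \<le> G\<^sup>2"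
    unfolding V_def using zero_le_power2[of "m k \<omega>"] by linarith
  ultimately show ?thesis ..
qed

lemma V_adapted: "V k \<in> borel_measurable (F k)"
proof -
  have "(\<lambda>p. (g (fst p) (snd p))\<^sup>2) \<in> borel_measurable (SS \<Otimes>\<^sub>M XX)"
    by measurable
  from kernel_app_path_measurable[OF this, of k] m_adapted[of k] show ?thesis
    unfolding V_def[abs_def] by simp
qed

text \<open>The increment bound \<open>2 * G\<close> adds the bounds for \<open>g\<close> and for
  its conditional mean. The partial sums are called \<open>martingale.S\<close>, to be kept apart
  from the parameter process \<open>S\<close>.\<close>

sublocale martingale: bounded_martingale_differences_variance M F \<xi> "2 * G" V "G\<^sup>2"
proof unfold_locales
  fix k
  show "subalgebra M (F k)"
    by (rule subalg)
  show "subalgebra (F j) (F i)" if "i \<le> j" for i j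
    by (rule F_mono[OF that])
  show "V k \<in> borel_measurable (F k)"
    by (rule V_adapted)
  have "S k \<in> F (Suc k) \<rightarrow>\<^sub>M SS" "m k \<in> borel_measurable (F (Suc k))"
    by (rule measurable_from_subalg[OF F_mono S_adapted] measurable_from_subalg[OF F_mono m_adapted]; simp)+
  with measurable_compose[OF measurable_Pair[OF _ X_adapted[of "Suc k"]] g_measurable, of "S k"]
  show "\<xi> k \<in> borel_measurable (F (Suc k))"
    unfolding \<xi>_def[abs_def] by simp
  show \<xi>_bound: "\<bar>\<xi> k \<omega>\<bar> \<le> 2 * G" if "\<omega> \<in> space M" for \<omega>
    unfolding \<xi>_def using g_bound[OF S_space[OF that] X_space[OF that], of k "Suc k"] m_bound[OF that, of k]
    by linarith
  show "0 \<le> V k \<omega> \<and> V k \<omega> \<le> G\<^sup>2" if "\<omega> \<in> space M" for \<omega>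
    by (rule V_bound[OF that])
  have mM: "m k \<in> borel_measurable M" and VM: "V k \<in> borel_measurable M"
    by (rule measurable_from_subalg[OF subalg m_adapted] measurable_from_subalg[OF subalg V_adapted])+
  note gM = g_path_measurable[of k "Suc k"]
  have gb: "\<And>\<omega>. \<omega> \<in> space M \<Longrightarrow> \<bar>g (S k \<omega>) (X (Suc k) \<omega>)\<bar> \<le> G"
    by (rule g_bound[OF S_space X_space])
  fix W :: "'w \<Rightarrow> real" and b
  assume W: "W \<in> borel_measurable (F k)" and Wb: "\<And>\<omega>. \<omega> \<in> space M \<Longrightarrow> \<bar>W \<omega>\<bar> \<le> b"
  have WM: "W \<in> borel_measurable M"
    by (rule measurable_from_subalg[OF subalg W])
  note int = integrable_mult_bounded[OF WM Wb]
  have ig: "integrable M (\<lambda>\<omega>. W \<omega> * g (S k \<omega>) (X (Suc k) \<omega>))"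
    by (rule int[OF _ gM gb]) simp_all
  have im: "integrable M (\<lambda>\<omega>. W \<omega> * m k \<omega>)"
    by (rule int[OF _ mM m_bound]) simp_all
  show "expectation (\<lambda>\<omega>. W \<omega> * \<xi> k \<omega>) = 0"
    unfolding \<xi>_def right_diff_distrib using ig im expectation_weighted_g(1)[OF W Wb] by simp
  have g2M: "(\<lambda>\<omega>. (g (S k \<omega>) (X (Suc k) \<omega>))\<^sup>2) \<in> borel_measurable M"
    using gM by measurable
  have ig2: "integrable M (\<lambda>\<omega>. W \<omega> * (g (S k \<omega>) (X (Suc k) \<omega>))\<^sup>2)"
    by (rule int[OF _ g2M, where d="G\<^sup>2"]) (simp_all add: square_le_square_bound gb)
  have m2M: "(\<lambda>\<omega>. (m k \<omega>)\<^sup>2) \<in> borel_measurable M"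
    using mM by measurable
  have im2: "integrable M (\<lambda>\<omega>. W \<omega> * (m k \<omega>)\<^sup>2)"
    by (rule int[OF _ m2M, where d="G\<^sup>2"]) (simp_all add: square_le_square_bound m_bound)
  have iV: "integrable M (\<lambda>\<omega>. W \<omega> * V k \<omega>)"
    by (rule int[OF _ VM, where d="G\<^sup>2"]) (simp_all add: V_bound)
  \<comment> \<open>\<open>W * m k\<close> is again a bounded weight known at time \<open>k\<close>.
    Used as such, it reduces the cross term in the expansion of \<open>(g - m k)^2\<close> to
    \<open>(m k)^2\<close>.\<close>
  have Wm: "(\<lambda>\<omega>. W \<omega> * m k \<omega>) \<in> borel_measurable (F k)"
    using W m_adapted by measurable
  have WmM: "(\<lambda>\<omega>. W \<omega> * m k \<omega>) \<in> borel_measurable M"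
    by (rule measurable_from_subalg[OF subalg Wm])
  have Wmb: "\<bar>W \<omega> * m k \<omega>\<bar> \<le> b * G" if "\<omega> \<in> space M" for \<omega>
    using Wb[OF that] m_bound[OF that, of k] by (auto simp: abs_mult intro!: mult_mono)
  have igm: "integrable M (\<lambda>\<omega>. W \<omega> * m k \<omega> * g (S k \<omega>) (X (Suc k) \<omega>))"
    by (rule integrable_mult_bounded[OF WmM Wmb gM gb]) simp_all
  have eq: "(\<lambda>\<omega>. W \<omega> * ((\<xi> k \<omega>)\<^sup>2 - V k \<omega>))
      = (\<lambda>\<omega>. W \<omega> * (g (S k \<omega>) (X (Suc k) \<omega>))\<^sup>2
          - 2 * (W \<omega> * m k \<omega> * g (S k \<omega>) (X (Suc k) \<omega>)) + W \<omega> * (m k \<omega>)\<^sup>2 - W \<omega> * V k \<omega>)"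
    by (simp add: \<xi>_def fun_eq_iff power2_eq_square algebra_simps)
  have "expectation (\<lambda>\<omega>. W \<omega> * (V k \<omega> + (m k \<omega>)\<^sup>2))
      = expectation (\<lambda>\<omega>. W \<omega> * V k \<omega>) + expectation (\<lambda>\<omega>. W \<omega> * (m k \<omega>)\<^sup>2)"
    unfolding distrib_left using iV im2 by simp
  moreover have "expectation (\<lambda>\<omega>. W \<omega> * m k \<omega> * g (S k \<omega>) (X (Suc k) \<omega>))
      = expectation (\<lambda>\<omega>. W \<omega> * (m k \<omega>)\<^sup>2)"
    using expectation_weighted_g(1)[OF Wm Wmb] by (simp add: power2_eq_square mult.assoc)
  ultimately show "expectation (\<lambda>\<omega>. W \<omega> * ((\<xi> k \<omega>)\<^sup>2 - V k \<omega>)) = 0"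
    unfolding eq using ig2 igm im2 iV expectation_weighted_g(2)[OF W Wb] by simp
qed

section \<open>Martingale approximation and the limit theorems for the adaptive chain\<close>

definition A :: "nat \<Rightarrow> 'w \<Rightarrow> real" where
  "A n \<omega> = (\<Sum>k=1..n. \<phi> (X k \<omega>) - (\<integral>x. \<phi> x \<partial>\<pi>))"

lemma A_measurable[measurable]: "A n \<in> borel_measurable M"
proof -
  note [measurable] = \<phi>(1)
  show ?thesis
    unfolding A_def[abs_def] by measurable
qed

text \<open>The constant of \<open>poisson_sol_lipschitz\<close>, with the uniform bound
  \<open>G\<close> inserted: it relates the sup-norm distance of two solutions to the uniform total
  variation distance of their kernels.\<close>

definition Lip :: real where
  "Lip = 2 * C * (2 * G) / (1 - \<rho>)"

text \<open>A real \<open>SUP\<close> is sure to dominate its members only when the family is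
  bounded above; the bound here is 1.\<close>

lemma tv_dist_le_adaptation_bound:
  assumes D: "adaptation_bound M XX P S D" and k: "1 \<le> k" and \<omega>: "\<omega> \<in> space M"
    and x: "x \<in> space XX"
  shows "tv_dist (P (S k \<omega>) x) (P (S (k - 1) \<omega>) x) \<le> D k \<omega>"
proof -
  have "tv_dist (P (S k \<omega>) x) (P (S (k - 1) \<omega>) x)
      \<le> (SUP x\<in>space XX. tv_dist (P (S k \<omega>) x) (P (S (k - 1) \<omega>) x))"
  proof (rule cSUP_upper[OF x])
    show "bdd_above ((\<lambda>x. tv_dist (P (S k \<omega>) x) (P (S (k - 1) \<omega>) x)) ` space XX)"
      by (rule bdd_aboveI2) (rule tv_dist_le_1[OF kernel_prob_space(1)[OF kernel[OF S_space[OF \<omega>]]]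
          kernel_prob_space(1)[OF kernel[OF S_space[OF \<omega>]]]])
  qed
  also have "\<dots> \<le> D k \<omega>"
    using D k \<omega> unfolding adaptation_bound_def by blast
  finally show ?thesis .
qed

lemma scaled_adaptation_measurable:
  assumes D: "adaptation_bound M XX P S D"
  shows "(\<lambda>\<omega>. real n powr (- p) * (\<Sum>k=1..n. D k \<omega>)) \<in> borel_measurable M"
proof -
  have "D k \<in> borel_measurable M" if "1 \<le> k" for k
    using D that unfolding adaptation_bound_def by blast
  then show ?thesis
    by (intro borel_measurable_times borel_measurable_const borel_measurable_sum) auto
qed

lemma g_increment:
  assumes D: "adaptation_bound M XX P S D" and \<omega>: "\<omega> \<in> space M" and x: "x \<in> space XX"
  shows "\<bar>g (S (Suc k) \<omega>) x - g (S k \<omega>) x\<bar> \<le> Lip * D (Suc k) \<omega>"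
proof -
  have "\<bar>g (S (Suc k) \<omega>) x - g (S k \<omega>) x\<bar>
      \<le> 2 * C * (2 * (4 * B * C / (1 - \<rho>)) * D (Suc k) \<omega>) / (1 - \<rho>)"
    by (rule poisson_sol_lipschitz[OF ergodic_kernel[OF S_space[OF \<omega>]] ergodic_kernel[OF S_space[OF \<omega>]]
          \<phi> _ x])
       (use tv_dist_le_adaptation_bound[OF D _ \<omega>, of "Suc k"] in auto)
  also have "\<dots> = Lip * D (Suc k) \<omega>"
    by (simp add: Lip_def G_def)
  finally show ?thesis .
qed

text \<open>Each centred term at time \<open>k + 1\<close> splits into the increment
  \<open>\<xi> k\<close>, the telescoping difference \<open>m k - m (Suc k)\<close>, and the change
  of solution \<open>g (S (Suc k)) - g (S k)\<close> evaluated at the one point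
  \<open>X (Suc k)\<close>.\<close>

lemma martingale_approximation:
  assumes D: "adaptation_bound M XX P S D" and \<omega>: "\<omega> \<in> space M"
  shows "\<bar>A n \<omega> - martingale.S n \<omega>\<bar> \<le> Lip * (\<Sum>k=1..n. D k \<omega>) + 2 * G"
proof -
  \<comment> \<open>The telescoped term is subtracted exactly during the induction and bounded by
    \<open>2 * G\<close> only afterwards, so that its bound does not accumulate.\<close>
  have "\<bar>A n \<omega> - martingale.S n \<omega> - (m 0 \<omega> - m n \<omega>)\<bar> \<le> Lip * (\<Sum>k=1..n. D k \<omega>)"
  proof (induction n)
    case 0
    show ?case
      by (simp add: A_def martingale.S_def)
  next
    case (Suc n)
    have "\<phi> (X (Suc n) \<omega>) - (\<integral>x. \<phi> x \<partial>\<pi>) = g (S (Suc n) \<omega>) (X (Suc n) \<omega>) - m (Suc n) \<omega>"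
      unfolding m_def
      by (rule ergodic_kernel.poisson_equation[OF ergodic_kernel[OF S_space[OF \<omega>]] \<phi> X_space[OF \<omega>],
            symmetric])
    then have "A (Suc n) \<omega> - martingale.S (Suc n) \<omega> - (m 0 \<omega> - m (Suc n) \<omega>)
        = (A n \<omega> - martingale.S n \<omega> - (m 0 \<omega> - m n \<omega>))
          + (g (S (Suc n) \<omega>) (X (Suc n) \<omega>) - g (S n \<omega>) (X (Suc n) \<omega>))"
      by (simp add: A_def martingale.S_def \<xi>_def)
    moreover have "\<bar>g (S (Suc n) \<omega>) (X (Suc n) \<omega>) - g (S n \<omega>) (X (Suc n) \<omega>)\<bar> \<le> Lip * D (Suc n) \<omega>"
      by (rule g_increment[OF D \<omega> X_space[OF \<omega>]])
    ultimately show ?case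
      using Suc.IH by (simp add: distrib_left)
  qed
  then show ?thesis
    using m_bound[OF \<omega>, of 0] m_bound[OF \<omega>, of n] by linarith
qed

lemma scaled_martingale_approximation:
  assumes D: "adaptation_bound M XX P S D" and \<omega>: "\<omega> \<in> space M"
  shows "\<bar>(A n \<omega> - martingale.S n \<omega>) * real n powr (- p)\<bar>
    \<le> Lip * (real n powr (- p) * (\<Sum>k=1..n. D k \<omega>)) + 2 * G * real n powr (- p)"
proof -
  have "\<bar>(A n \<omega> - martingale.S n \<omega>) * real n powr (- p)\<bar>
      = \<bar>A n \<omega> - martingale.S n \<omega>\<bar> * real n powr (- p)"
    by (simp add: abs_mult)
  also have "\<dots> \<le> (Lip * (\<Sum>k=1..n. D k \<omega>) + 2 * G) * real n powr (- p)"
    by (intro mult_right_mono martingale_approximation[OF D \<omega>]) simp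
  finally show ?thesis
    by (simp add: algebra_simps)
qed

lemma scaled_constant_tendsto_0:
  "0 < p \<Longrightarrow> (\<lambda>n. 2 * G * real n powr (- p)) \<longlonglongrightarrow> 0"
  by (intro tendsto_mult_right_zero tendsto_neg_powr filterlim_real_sequentially) simp

text \<open>The scale is left general: \<open>p = 1\<close> serves the weak law of large numbers and
  \<open>p = 1 / 2\<close> the central limit theorem. Positivity of \<open>p\<close> removes the
  boundary term \<open>2 * G\<close>.\<close>

lemma weakly_waning_approximation:
  assumes p: "0 < p" and waning: "weakly_waning M XX P S p"
  shows "tendsto_in_prob M (\<lambda>n \<omega>. (A n \<omega> - martingale.S n \<omega>) * real n powr (- p)) 0"
proof -
  from waning obtain D where D: "adaptation_bound M XX P S D"
    and D_lim: "tendsto_in_prob M (\<lambda>n \<omega>. real n powr (- p) * (\<Sum>k=1..n. D k \<omega>)) 0"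
    unfolding weakly_waning_def by blast
  note sum_measurable = scaled_adaptation_measurable[OF D]
  have "isCont (\<lambda>x. Lip * x) 0"
    by (intro continuous_intros)
  from tendsto_in_prob_isCont[OF sum_measurable D_lim this]
  have D_part: "tendsto_in_prob M (\<lambda>n \<omega>. Lip * (real n powr (- p) * (\<Sum>k=1..n. D k \<omega>))) 0"
    by simp
  have "tendsto_in_prob M (\<lambda>n \<omega>. 2 * G * real n powr (- p)) 0"
    by (rule AE_imp_tendsto_in_prob[OF borel_measurable_const AE_I2[OF scaled_constant_tendsto_0[OF p]]])
  from tendsto_in_prob_add[OF borel_measurable_times[OF borel_measurable_const sum_measurable] D_part
      borel_measurable_const this]
  have lim: "tendsto_in_prob M
      (\<lambda>n \<omega>. Lip * (real n powr (- p) * (\<Sum>k=1..n. D k \<omega>)) + 2 * G * real n powr (- p)) (0 + 0)" .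
  show ?thesis
  proof (rule tendsto_in_prob_dominated)
    show "tendsto_in_prob M
      (\<lambda>n \<omega>. Lip * (real n powr (- p) * (\<Sum>k=1..n. D k \<omega>)) + 2 * G * real n powr (- p)) 0"
      using lim unfolding add_0_left .
    show "(\<lambda>\<omega>. Lip * (real n powr (- p) * (\<Sum>k=1..n. D k \<omega>)) + 2 * G * real n powr (- p))
        \<in> borel_measurable M" for n
      by (intro borel_measurable_add borel_measurable_times sum_measurable borel_measurable_const)
    show "\<bar>(A n \<omega> - martingale.S n \<omega>) * real n powr (- p) - 0\<bar>
        \<le> \<bar>Lip * (real n powr (- p) * (\<Sum>k=1..n. D k \<omega>)) + 2 * G * real n powr (- p)\<bar>"
      if "\<omega> \<in> space M" for n \<omega>
      unfolding diff_0_right by (rule order_trans[OF scaled_martingale_approximation[OF D that] abs_ge_self])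
  qed
qed

lemma strongly_waning_imp_weakly_waning:
  assumes "strongly_waning M XX P S p"
  shows "weakly_waning M XX P S p"
proof -
  from assms obtain D where D: "adaptation_bound M XX P S D"
    and D_lim: "AE \<omega> in M. (\<lambda>n. real n powr (- p) * (\<Sum>k=1..n. D k \<omega>)) \<longlonglongrightarrow> 0"
    unfolding strongly_waning_def by blast
  from AE_imp_tendsto_in_prob[OF scaled_adaptation_measurable[OF D] D_lim] D show ?thesis
    unfolding weakly_waning_def by blast
qed

lemma average_eq:
  assumes n: "0 < n"
  shows "1 / real n * (\<Sum>k=1..n. \<phi> (X k \<omega>)) - (\<integral>x. \<phi> x \<partial>\<pi>)
    = (A n \<omega> - martingale.S n \<omega>) * real n powr (- 1) + martingale.S n \<omega> / real n"
proof -
  have "real n powr (- 1) = 1 / real n"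
    using n by (simp add: powr_minus_divide)
  then have "(A n \<omega> - martingale.S n \<omega>) * real n powr (- 1) + martingale.S n \<omega> / real n = A n \<omega> / real n"
    by (simp add: diff_divide_distrib)
  also have "\<dots> = 1 / real n * (\<Sum>k=1..n. \<phi> (X k \<omega>)) - (\<integral>x. \<phi> x \<partial>\<pi>)"
    using n by (simp add: A_def sum_subtractf diff_divide_distrib)
  finally show ?thesis ..
qed

lemma weak_law_of_large_numbers:
  assumes "weakly_waning M XX P S 1"
  shows "tendsto_in_prob M (\<lambda>n \<omega>. 1 / real n * (\<Sum>k=1..n. \<phi> (X k \<omega>))) (\<integral>x. \<phi> x \<partial>\<pi>)"
proof (rule tendsto_in_prob_dominated)
  let ?Z = "\<lambda>n \<omega>. (A n \<omega> - martingale.S n \<omega>) * real n powr (- 1) + martingale.S n \<omega> / real n"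
  show "?Z n \<in> borel_measurable M" for n
    by measurable
  have "tendsto_in_prob M ?Z (0 + 0)"
    by (rule tendsto_in_prob_add[OF _ weakly_waning_approximation[OF zero_less_one assms]
          _ martingale.weak_law]) measurable
  then show "tendsto_in_prob M ?Z 0"
    by simp
  show "\<bar>1 / real n * (\<Sum>k=1..n. \<phi> (X k \<omega>)) - (\<integral>x. \<phi> x \<partial>\<pi>)\<bar> \<le> \<bar>?Z n \<omega>\<bar>" if "0 < n" for n \<omega>
    unfolding average_eq[OF that] by (rule order_refl)
qed

text \<open>The approximation error is bounded path by path, so it suffices to work on the almost
  sure event where both the adaptation averages and the martingale averages vanish.\<close>

lemma strong_law_of_large_numbers:
  assumes "strongly_waning M XX P S 1"
  shows "AE \<omega> in M. (\<lambda>n. 1 / real n * (\<Sum>k=1..n. \<phi> (X k \<omega>))) \<longlonglongrightarrow> (\<integral>x. \<phi> x \<partial>\<pi>)"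
proof -
  from assms obtain D where D: "adaptation_bound M XX P S D"
    and D_lim: "AE \<omega> in M. (\<lambda>n. real n powr (- 1) * (\<Sum>k=1..n. D k \<omega>)) \<longlonglongrightarrow> 0"
    unfolding strongly_waning_def by blast
  show ?thesis
    using D_lim martingale.strong_law AE_space
  proof eventually_elim
    case (elim \<omega>)
    let ?u = "\<lambda>n. Lip * (real n powr (- 1) * (\<Sum>k=1..n. D k \<omega>)) + 2 * G * real n powr (- 1)"
    have u: "?u \<longlonglongrightarrow> 0"
      by (rule tendsto_add_zero[OF tendsto_mult_right_zero[OF elim(1)] scaled_constant_tendsto_0[OF zero_less_one]])
    have "(\<lambda>n. (A n \<omega> - martingale.S n \<omega>) * real n powr (- 1)) \<longlonglongrightarrow> 0"
      by (rule Lim_null_comparison[OF always_eventually[OF allI] u])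
         (simp only: real_norm_def scaled_martingale_approximation[OF D elim(3), where p=1])
    from tendsto_add_zero[OF this elim(2)]
    have "(\<lambda>n. 1 / real n * (\<Sum>k=1..n. \<phi> (X k \<omega>)) - (\<integral>x. \<phi> x \<partial>\<pi>)) \<longlonglongrightarrow> 0"
    proof (rule Lim_transform_eventually)
      show "\<forall>\<^sub>F n in sequentially.
          (A n \<omega> - martingale.S n \<omega>) * real n powr (- 1) + martingale.S n \<omega> / real n
          = 1 / real n * (\<Sum>k=1..n. \<phi> (X k \<omega>)) - (\<integral>x. \<phi> x \<partial>\<pi>)"
        using eventually_gt_at_top[of 0] by eventually_elim (rule average_eq[symmetric])
    qed
    then show ?case
      by (rule LIM_zero_cancel)
  qed
qed

text \<open>The normalised sum and the normalised martingale differ by a term tending to zero in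
  probability, so they have the same limit of characteristic functions.\<close>

lemma central_limit_theorem_adaptive:
  assumes waning: "weakly_waning M XX P S (1 / 2)" and v: "0 \<le> v"
    and variance: "tendsto_in_prob M (\<lambda>n \<omega>. 1 / real n * (\<Sum>k=1..n.
        kernel_app (P (S (k - 1) \<omega>)) (\<lambda>y. (g (S (k - 1) \<omega>) y)\<^sup>2) (X (k - 1) \<omega>)
        - (kernel_app (P (S (k - 1) \<omega>)) (g (S (k - 1) \<omega>)) (X (k - 1) \<omega>))\<^sup>2)) v"
  shows "weak_conv_m
    (\<lambda>n. distr M borel (\<lambda>\<omega>. 1 / sqrt (real n) * (\<Sum>k=1..n. \<phi> (X k \<omega>) - (\<integral>x. \<phi> x \<partial>\<pi>))))
    (centred_normal v)"
proof (rule levy_continuity)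
  let ?Y = "\<lambda>n \<omega>. 1 / sqrt (real n) * (\<Sum>k=1..n. \<phi> (X k \<omega>) - (\<integral>x. \<phi> x \<partial>\<pi>))"
  have Y: "?Y n = (\<lambda>\<omega>. A n \<omega> / sqrt (real n))" for n
    by (simp add: A_def)
  have Y_measurable[measurable]: "?Y n \<in> borel_measurable M" for n
    unfolding Y by measurable
  show "real_distribution (distr M borel (?Y n))" for n
    by (rule real_distribution_distr) measurable
  show "real_distribution (centred_normal v)"
    by (rule char_centred_normal(1)[OF v])
  fix t
  \<comment> \<open>Only a shift of index: the hypothesis sums over \<open>k = 1..n\<close> at time
    \<open>k - 1\<close>, while \<open>martingale.Q n\<close> sums over
    \<open>k < n\<close>.\<close>
  have "(\<lambda>n \<omega>. martingale.Q n \<omega> / real n) = (\<lambda>n \<omega>. 1 / real n * (\<Sum>k=1..n.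
        kernel_app (P (S (k - 1) \<omega>)) (\<lambda>y. (g (S (k - 1) \<omega>) y)\<^sup>2) (X (k - 1) \<omega>)
        - (kernel_app (P (S (k - 1) \<omega>)) (g (S (k - 1) \<omega>)) (X (k - 1) \<omega>))\<^sup>2))"
    by (simp add: martingale.Q_def V_def m_def sum.atLeast1_atMost_eq)
  with variance have "tendsto_in_prob M (\<lambda>n \<omega>. martingale.Q n \<omega> / real n) v"
    by simp
  then have clt: "(\<lambda>n. CLINT \<omega>|M. iexp (t * (martingale.S n \<omega> / sqrt (real n)))) \<longlonglongrightarrow> exp (- (t\<^sup>2) * v / 2)"
    by (rule martingale.central_limit)
  have "(A n \<omega> - martingale.S n \<omega>) * real n powr (- (1 / 2))
      = ?Y n \<omega> - martingale.S n \<omega> / sqrt (real n)" for n \<omega>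
    by (simp add: A_def powr_minus_divide powr_half_sqrt diff_divide_distrib)
  with weakly_waning_approximation[OF _ waning]
  have "tendsto_in_prob M (\<lambda>n \<omega>. ?Y n \<omega> - martingale.S n \<omega> / sqrt (real n)) 0"
    by simp
  then have "(\<lambda>n. (CLINT \<omega>|M. iexp (t * ?Y n \<omega>))
      - (CLINT \<omega>|M. iexp (t * (martingale.S n \<omega> / sqrt (real n))))) \<longlonglongrightarrow> 0"
    by (intro expectation_iexp_diff_tendsto_0) measurable
  from tendsto_add[OF this clt] have "(\<lambda>n. CLINT \<omega>|M. iexp (t * ?Y n \<omega>)) \<longlonglongrightarrow> exp (- (t\<^sup>2) * v / 2)"
    by simp
  moreover have "char (distr M borel (?Y n)) t = (CLINT \<omega>|M. iexp (t * ?Y n \<omega>))" for n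
    unfolding char_def by (rule integral_distr) measurable
  ultimately show "(\<lambda>n. char (distr M borel (?Y n)) t) \<longlonglongrightarrow> char (centred_normal v) t"
    by (simp only: char_centred_normal(2)[OF v])
qed

end

theorem theorem9:
  fixes M :: "'w measure" and F :: "nat \<Rightarrow> 'w measure"
    and XX :: "'x measure" and SS :: "'s measure"
    and \<pi> :: "'x measure" and P :: "'s \<Rightarrow> 'x \<Rightarrow> 'x measure"
    and S :: "nat \<Rightarrow> 'w \<Rightarrow> 's" and X :: "nat \<Rightarrow> 'w \<Rightarrow> 'x"
    and \<phi> :: "'x \<Rightarrow> real" and C \<rho> :: real
  assumes "prob_space \<pi>" and "sets \<pi> = sets XX"
    and kernel: "\<And>s. s \<in> space SS \<Longrightarrow> P s \<in> XX \<rightarrow>\<^sub>M prob_algebra XX"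
    and invariant: "\<And>s. s \<in> space SS \<Longrightarrow> Giry_Monad.bind \<pi> (P s) = \<pi>"
    and joint_measurable: "\<And>A. A \<in> sets XX \<Longrightarrow>
      (\<lambda>(s, x). measure (P s x) A) \<in> borel_measurable (SS \<Otimes>\<^sub>M XX)"
    and "prob_space M" and "filtration (space M) F" and "\<And>k. subalgebra M (F k)"
    and S_adapted: "\<And>k. S k \<in> F k \<rightarrow>\<^sub>M SS"
    and X_adapted: "\<And>k. X k \<in> F k \<rightarrow>\<^sub>M XX"
    and transition: "\<And>k A. A \<in> sets XX \<Longrightarrow>
      AE \<omega> in M. real_cond_exp M (F k) (indicator {\<omega>\<in>space M. X (Suc k) \<omega> \<in> A}) \<omega>
        = measure (P (S k \<omega>) (X k \<omega>)) A"
    and "0 \<le> \<rho>" and "\<rho> < 1"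
    and ergodic: "\<And>s x k. s \<in> space SS \<Longrightarrow> x \<in> space XX \<Longrightarrow>
      tv_dist (kernel_power XX (P s) k x) \<pi> \<le> C * \<rho> ^ k"
    and "\<phi> \<in> borel_measurable XX" and "bounded (\<phi> ` space XX)"
  shows
    "(weakly_waning M XX P S 1 \<longrightarrow>
        tendsto_in_prob M (\<lambda>n \<omega>. 1 / real n * (\<Sum>k=1..n. \<phi> (X k \<omega>))) (\<integral>x. \<phi> x \<partial>\<pi>)) \<and>
     (strongly_waning M XX P S 1 \<longrightarrow>
        (AE \<omega> in M. (\<lambda>n. 1 / real n * (\<Sum>k=1..n. \<phi> (X k \<omega>))) \<longlonglongrightarrow> (\<integral>x. \<phi> x \<partial>\<pi>))) \<and>
     (\<forall>\<sigma>2\<ge>0.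
        (weakly_waning M XX P S (1 / 2) \<or> strongly_waning M XX P S (1 / 2)) \<and>
        (let g = (\<lambda>s. poisson_sol XX \<pi> (P s) \<phi>) in
          tendsto_in_prob M
            (\<lambda>n \<omega>. 1 / real n * (\<Sum>k=1..n.
               kernel_app (P (S (k - 1) \<omega>)) (\<lambda>y. (g (S (k - 1) \<omega>) y)\<^sup>2) (X (k - 1) \<omega>)
               - (kernel_app (P (S (k - 1) \<omega>)) (g (S (k - 1) \<omega>)) (X (k - 1) \<omega>))\<^sup>2))
            \<sigma>2) \<longrightarrow>
        weak_conv_m
          (\<lambda>n. distr M borel (\<lambda>\<omega>. 1 / sqrt (real n) * (\<Sum>k=1..n. \<phi> (X k \<omega>) - (\<integral>x. \<phi> x \<partial>\<pi>))))
          (centred_normal \<sigma>2))"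
proof -
  from \<open>bounded (\<phi> ` space XX)\<close> obtain B where B: "\<And>x. x \<in> space XX \<Longrightarrow> \<bar>\<phi> x\<bar> \<le> B"
    unfolding bounded_iff by auto
  interpret adaptive_markov_chain M F XX SS \<pi> P S X \<phi> B C \<rho>
    by (rule adaptive_markov_chain.intro[OF \<open>prob_space M\<close> adaptive_markov_chain_axioms.intro])
       (fact assms B)+
  show ?thesis
    unfolding Let_def
  proof (intro conjI impI allI)
    fix \<sigma>2 :: real
    assume "0 \<le> \<sigma>2" and "(weakly_waning M XX P S (1 / 2) \<or> strongly_waning M XX P S (1 / 2)) \<and>
      tendsto_in_prob M (\<lambda>n \<omega>. 1 / real n * (\<Sum>k=1..n.
        kernel_app (P (S (k - 1) \<omega>)) (\<lambda>y. (g (S (k - 1) \<omega>) y)\<^sup>2) (X (k - 1) \<omega>)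
        - (kernel_app (P (S (k - 1) \<omega>)) (g (S (k - 1) \<omega>)) (X (k - 1) \<omega>))\<^sup>2)) \<sigma>2"
    then show "weak_conv_m
      (\<lambda>n. distr M borel (\<lambda>\<omega>. 1 / sqrt (real n) * (\<Sum>k=1..n. \<phi> (X k \<omega>) - (\<integral>x. \<phi> x \<partial>\<pi>))))
      (centred_normal \<sigma>2)"
      using strongly_waning_imp_weakly_waning[of "1 / 2"] central_limit_theorem_adaptive[of \<sigma>2]
      by argo
  qed (erule weak_law_of_large_numbers strong_law_of_large_numbers)+
qed

end
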